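(* Let $\mathbf C$ be a categorical model of Aff with tensor unit $I$, let $\mathbf C_a = \mathbf C / I$ and let $U : \mathbf C_a \to \mathbf C$ be the forgetful functor. For every well-formed type $\Theta \vdash A$, $$[\![\Theta \vdash A]\!] \circ U^{\times |\Theta|} = U \circ [\![\Theta \vdash A]\!]_a : \mathbf C_a^{|\Theta|} \to \mathbf C .$$ Therefore, for every closed type $\cdot \vdash A$, one has $[\![A]\!] = U [\![A]\!]_a$.
   Context: Types. Fix a set $\mathcal A$ of atomic types. Types are $A,B ::= X \mid I \mid \mathbf A \mid A+B \mid A \otimes B \mid \mu X.A$ with $\mathbf A \in \mathcal A$ and $X$ a type variable. A type context $\Theta = X_1,\dots,X_n$ is a list of distinct type variables, $|\Theta| = n$. $\Theta \vdash A$ (well-formed) is generated by: $\Theta \vdash \Theta_i$ (the $i$-th variable); $\Theta \vdash I$; $\Theta \vdash \mathbf A$; if $\Theta \vdash A$ and $\Theta \vdash B$ then $\Theta \vdash A+B$ and $\Theta \vdash A \otimes B$; if $\Theta, X \vdash A$ then $\Theta \vdash \mu X.A$. A type is closed if $\cdot \vdash A$ (empty context). Model. A categorical model of Aff consists of: (1) a symmetric monoidal category $(\mathbf C,\otimes,I,\alpha,\lambda,\rho,\sigma)$; (2) an initial object $\varnothing$ and binary coproducts $(A+B,\mathrm{left}_{A,B},\mathrm{right}_{A,B})$; (3) $\otimes$ distributes over $+$; (4) for each atomic type $\mathbf A \in \mathcal A$ an object $\mathbf A$ of $\mathbf C$ and a morphism $\diamond_{\mathbf A} : \mathbf A \to I$;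 (5) $\mathbf C$ has all $\omega$-colimits and $\otimes : \mathbf C \times \mathbf C \to \mathbf C$ is $\omega$-cocontinuous (preserves $\omega$-colimits); (6) $\mathbf C$ is enriched in pointed dcpos and strict Scott-continuous maps (hom-sets are pointed dcpos with least elements $\perp_{A,B}$, composition is Scott-continuous and strict in each argument), and the symmetric monoidal and coproduct structures are dcpo-enriched (act Scott-continuously on hom-sets). Slice category. Objects of $\mathbf C_a = \mathbf C/I$ are pairs $(A, \diamond_A : A \to I)$; morphisms $(A,\diamond_A)\to(B,\diamond_B)$ are $f : A \to B$ in $\mathbf C$ with $\diamond_B \circ f = \diamond_A$. $U(A,\diamond_A)=A$, $U(f)=f$. $\mathbf C_a$ has the functors $(A,\diamond_A)\otimes_a(B,\diamond_B) = (A\otimes B, \lambda_I\circ(\diamond_A\otimes\diamond_B))$, $f \otimes_a g = f\otimes g$, and $(A,\diamond_A)+_a(B,\diamond_B) = (A+B,[\diamond_A,\diamond_B])$, $f+_a g = f+g$. Parameterised initial algebras. Fix a choice of $\omega$-colimits in $\mathbf C$. In $\mathbf C_a$ the chosen initial object is $\varnothing$ with its unique map to $I$, and the chosen colimit of an $\omega$-diagram $D$ with objects $(D_i,\diamond_i)$ is $((M,\diamond_M),\mu_i)$ where $(M,\mu_i)$ is the chosen colimit of $UD$ and $\diamond_M\circ\mu_i=\diamond_i$. For an $\omega$-cocontinuous $T : \mathbf A\times\mathbf B\to\mathbf B$ (with $\mathbf B=\mathbf C$ or $\mathbf C_a$), its parameterised initial algebra $(T^\dagger,\tau)$ has $T^\dagger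 A$ = chosen colimit (cocone $\mu_i$) of the initial sequence $\varnothing\to T(A,\varnothing)\to T(A,T(A,\varnothing))\to\cdots$, $T^\dagger f$ the induced map, and $\tau_A : T(A,T^\dagger A)\to T^\dagger A$ the unique map with $\tau_A\circ T(A,\mu_i)=\mu_{i+1}$; then $(T^\dagger A,\tau_A)$ is an initial $T(A,-)$-algebra. Type interpretations. $K_X$ is the constant functor at $X$, $\Pi_i$ the $i$-th projection. The standard interpretation $[\![\Theta\vdash A]\!] : \mathbf C^{|\Theta|}\to\mathbf C$: $[\![\Theta\vdash\Theta_i]\!]=\Pi_i$; $[\![\Theta\vdash I]\!]=K_I$; $[\![\Theta\vdash\mathbf A]\!]=K_{\mathbf A}$; $[\![\Theta\vdash A\star B]\!]=\star\circ\langle[\![\Theta\vdash A]\!],[\![\Theta\vdash B]\!]\rangle$ for $\star\in\{+,\otimes\}$; $[\![\Theta\vdash\mu X.A]\!]=[\![\Theta,X\vdash A]\!]^\dagger$. The affine interpretation $[\![\Theta\vdash A]\!]_a : \mathbf C_a^{|\Theta|}\to\mathbf C_a$ is defined by the same clauses in $\mathbf C_a$, with $K_{(I,\mathrm{id}_I)}$, $K_{(\mathbf A,\diamond_{\mathbf A})}$, $+_a$, $\otimes_a$ in place of $K_I$, $K_{\mathbf A}$, $+$, $\otimes$. For closed $A$, $[\![A]\!]=[\![\cdot\vdash A]\!]( * )$ and $[\![A]\!]_a=[\![\cdot\vdash A]\!]_a( * )$, with $*$ the object of the terminal category. *)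

theory Defs
  imports Main
begin

datatype ('a, 'v) ty =
    TVar 'v
  | TUnit
  | TAtom 'a
  | TSum "('a, 'v) ty" "('a, 'v) ty"
  | TTensor "('a, 'v) ty" "('a, 'v) ty"
  | TMu 'v "('a, 'v) ty"

text \<open>The distinctness premises of the leaf rules ensure that only lists of distinct
  variables occur as contexts anywhere in a derivation.\<close>

inductive wf_ty :: "'a set \<Rightarrow> 'v list \<Rightarrow> ('a, 'v) ty \<Rightarrow> bool" for \<A> where
  wf_TVar: "distinct \<Theta> \<Longrightarrow> i < length \<Theta> \<Longrightarrow> wf_ty \<A> \<Theta> (TVar (\<Theta> ! i))"
| wf_TUnit: "distinct \<Theta> \<Longrightarrow> wf_ty \<A> \<Theta> TUnit"
| wf_TAtom: "distinct \<Theta> \<Longrightarrow> a \<in> \<A> \<Longrightarrow> wf_ty \<A> \<Theta> (TAtom a)"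
| wf_TSum: "wf_ty \<A> \<Theta> A \<Longrightarrow> wf_ty \<A> \<Theta> B \<Longrightarrow> wf_ty \<A> \<Theta> (TSum A B)"
| wf_TTensor: "wf_ty \<A> \<Theta> A \<Longrightarrow> wf_ty \<A> \<Theta> B \<Longrightarrow> wf_ty \<A> \<Theta> (TTensor A B)"
| wf_TMu: "wf_ty \<A> (\<Theta> @ [X]) A \<Longrightarrow> wf_ty \<A> \<Theta> (TMu X A)"

abbreviation closed_ty :: "'a set \<Rightarrow> ('a, 'v) ty \<Rightarrow> bool" where
  "closed_ty \<A> A \<equiv> wf_ty \<A> [] A"

record ('o, 'm) cat =
  Obj :: "'o set"
  Arr :: "'m set"
  Dom :: "'m \<Rightarrow> 'o"
  Cod :: "'m \<Rightarrow> 'o"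
  Idt :: "'o \<Rightarrow> 'm"
  Cmp :: "'m \<Rightarrow> 'm \<Rightarrow> 'm"  (infixr "\<cdot>\<index>" 75)

definition hom :: "('o, 'm, 'z) cat_scheme \<Rightarrow> 'o \<Rightarrow> 'o \<Rightarrow> 'm set" where
  "hom C A B = {f \<in> Arr C. Dom C f = A \<and> Cod C f = B}"

locale category =
  fixes C :: "('o, 'm, 'z) cat_scheme" (structure)
  assumes dom_obj: "f \<in> Arr C \<Longrightarrow> Dom C f \<in> Obj C"
    and cod_obj: "f \<in> Arr C \<Longrightarrow> Cod C f \<in> Obj C"
    and idt_hom: "A \<in> Obj C \<Longrightarrow> Idt C A \<in> hom C A A"
    and cmp_hom: "f \<in> hom C A B \<Longrightarrow> g \<in> hom C B D \<Longrightarrow> g \<cdot> f \<in> hom C A D"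
    and idt_left: "f \<in> hom C A B \<Longrightarrow> Idt C B \<cdot> f = f"
    and idt_right: "f \<in> hom C A B \<Longrightarrow> f \<cdot> Idt C A = f"
    and cmp_assoc: "f \<in> hom C A B \<Longrightarrow> g \<in> hom C B D \<Longrightarrow> h \<in> hom C D E \<Longrightarrow>
          (h \<cdot> g) \<cdot> f = h \<cdot> (g \<cdot> f)"

definition iso_arr :: "('o, 'm, 'z) cat_scheme \<Rightarrow> 'o \<Rightarrow> 'o \<Rightarrow> 'm \<Rightarrow> bool" where
  "iso_arr C A B f \<longleftrightarrow> f \<in> hom C A B \<and>
     (\<exists>g \<in> hom C B A. g \<cdot>\<^bsub>C\<^esub> f = Idt C A \<and> f \<cdot>\<^bsub>C\<^esub> g = Idt C B)"

record ('o1, 'm1, 'o2, 'm2) fctr =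
  Fo :: "'o1 \<Rightarrow> 'o2"
  Fa :: "'m1 \<Rightarrow> 'm2"

definition is_functor ::
  "('o1, 'm1, 'y) cat_scheme \<Rightarrow> ('o2, 'm2, 'z) cat_scheme \<Rightarrow> ('o1, 'm1, 'o2, 'm2) fctr \<Rightarrow> bool" where
  "is_functor C D F \<longleftrightarrow>
     (\<forall>A \<in> Obj C. Fo F A \<in> Obj D \<and> Fa F (Idt C A) = Idt D (Fo F A)) \<and>
     (\<forall>A B. \<forall>f \<in> hom C A B. Fa F f \<in> hom D (Fo F A) (Fo F B)) \<and>
     (\<forall>A B E. \<forall>f \<in> hom C A B. \<forall>g \<in> hom C B E. Fa F (g \<cdot>\<^bsub>C\<^esub> f) = Fa F g \<cdot>\<^bsub>D\<^esub> Fa F f)"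

text \<open>Equality of functors from \<open>C\<close> to \<open>D\<close>; the values outside of \<open>C\<close> of the
  underlying HOL functions carry no meaning and are not compared.\<close>

definition functor_eq ::
  "('o1, 'm1, 'y) cat_scheme \<Rightarrow> ('o2, 'm2, 'z) cat_scheme \<Rightarrow>
   ('o1, 'm1, 'o2, 'm2) fctr \<Rightarrow> ('o1, 'm1, 'o2, 'm2) fctr \<Rightarrow> bool" where
  "functor_eq C D F G \<longleftrightarrow> is_functor C D F \<and> is_functor C D G \<and>
     (\<forall>A \<in> Obj C. Fo F A = Fo G A) \<and> (\<forall>f \<in> Arr C. Fa F f = Fa G f)"

definition fcomp ::
  "('o2, 'm2, 'o3, 'm3) fctr \<Rightarrow> ('o1, 'm1, 'o2, 'm2) fctr \<Rightarrow> ('o1, 'm1, 'o3, 'm3) fctr"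
  (infixr "\<circ>\<^sub>F" 70) where
  "G \<circ>\<^sub>F F = \<lparr>Fo = Fo G \<circ> Fo F, Fa = Fa G \<circ> Fa F\<rparr>"

definition ftuple ::
  "('o1, 'm1, 'o2, 'm2) fctr \<Rightarrow> ('o1, 'm1, 'o3, 'm3) fctr \<Rightarrow>
   ('o1, 'm1, 'o2 \<times> 'o3, 'm2 \<times> 'm3) fctr" where
  "ftuple F G = \<lparr>Fo = (\<lambda>A. (Fo F A, Fo G A)), Fa = (\<lambda>f. (Fa F f, Fa G f))\<rparr>"

definition fconst :: "('o2, 'm2, 'z) cat_scheme \<Rightarrow> 'o2 \<Rightarrow> ('o1, 'm1, 'o2, 'm2) fctr" where
  "fconst D X = \<lparr>Fo = (\<lambda>_. X), Fa = (\<lambda>_. Idt D X)\<rparr>"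

definition prod_cat ::
  "('o1, 'm1, 'y) cat_scheme \<Rightarrow> ('o2, 'm2, 'z) cat_scheme \<Rightarrow> ('o1 \<times> 'o2, 'm1 \<times> 'm2) cat" where
  "prod_cat C D = \<lparr>Obj = Obj C \<times> Obj D, Arr = Arr C \<times> Arr D,
     Dom = map_prod (Dom C) (Dom D), Cod = map_prod (Cod C) (Cod D),
     Idt = map_prod (Idt C) (Idt D),
     Cmp = (\<lambda>g f. (fst g \<cdot>\<^bsub>C\<^esub> fst f, snd g \<cdot>\<^bsub>D\<^esub> snd f))\<rparr>"

text \<open>The \<open>n\<close>-th power of a category has lists of length \<open>n\<close> as objects and arrows; for
  \<open>n = 0\<close> this is the terminal category, with object \<open>[]\<close>. The functor \<open>snoc\<close> is the
  identification of \<open>C\<^sup>n \<times> C\<close> with the \<open>(n+1)\<close>-st power of \<open>C\<close>.\<close>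

definition power_cat :: "('o, 'm, 'z) cat_scheme \<Rightarrow> nat \<Rightarrow> ('o list, 'm list) cat" where
  "power_cat C n = \<lparr>Obj = {As. length As = n \<and> set As \<subseteq> Obj C},
     Arr = {fs. length fs = n \<and> set fs \<subseteq> Arr C},
     Dom = map (Dom C), Cod = map (Cod C), Idt = map (Idt C), Cmp = map2 (Cmp C)\<rparr>"

definition fpower :: "('o1, 'm1, 'o2, 'm2) fctr \<Rightarrow> ('o1 list, 'm1 list, 'o2 list, 'm2 list) fctr" where
  "fpower F = \<lparr>Fo = map (Fo F), Fa = map (Fa F)\<rparr>"

definition fproj :: "nat \<Rightarrow> ('o list, 'm list, 'o, 'm) fctr" where
  "fproj i = \<lparr>Fo = (\<lambda>As. As ! i), Fa = (\<lambda>fs. fs ! i)\<rparr>"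

definition snoc :: "('o list \<times> 'o, 'm list \<times> 'm, 'o list, 'm list) fctr" where
  "snoc = \<lparr>Fo = (\<lambda>(As, A). As @ [A]), Fa = (\<lambda>(fs, f). fs @ [f])\<rparr>"

text \<open>A functor out of the ordinal \<open>\<omega>\<close> is given by its objects \<open>D\<^sub>i\<close> and the arrows
  \<open>D\<^sub>i \<rightarrow> D\<^bsub>i+1\<^esub>\<close>.\<close>

type_synonym ('o, 'm) seq = "(nat \<Rightarrow> 'o) \<times> (nat \<Rightarrow> 'm)"

definition omega_diagram :: "('o, 'm, 'z) cat_scheme \<Rightarrow> ('o, 'm) seq \<Rightarrow> bool" where
  "omega_diagram C D \<longleftrightarrow>
     (\<forall>i. fst D i \<in> Obj C \<and> snd D i \<in> hom C (fst D i) (fst D (Suc i)))"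

definition is_cocone ::
  "('o, 'm, 'z) cat_scheme \<Rightarrow> ('o, 'm) seq \<Rightarrow> 'o \<Rightarrow> (nat \<Rightarrow> 'm) \<Rightarrow> bool" where
  "is_cocone C D M \<mu> \<longleftrightarrow> M \<in> Obj C \<and>
     (\<forall>i. \<mu> i \<in> hom C (fst D i) M \<and> \<mu> (Suc i) \<cdot>\<^bsub>C\<^esub> snd D i = \<mu> i)"

definition is_colimit ::
  "('o, 'm, 'z) cat_scheme \<Rightarrow> ('o, 'm) seq \<Rightarrow> 'o \<Rightarrow> (nat \<Rightarrow> 'm) \<Rightarrow> bool" where
  "is_colimit C D M \<mu> \<longleftrightarrow> is_cocone C D M \<mu> \<and>
     (\<forall>N \<nu>. is_cocone C D N \<nu> \<longrightarrow> (\<exists>!h. h \<in> hom C M N \<and> (\<forall>i. h \<cdot>\<^bsub>C\<^esub> \<mu> i = \<nu> i)))"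

definition map_seq :: "('o1, 'm1, 'o2, 'm2) fctr \<Rightarrow> ('o1, 'm1) seq \<Rightarrow> ('o2, 'm2) seq" where
  "map_seq F D = (Fo F \<circ> fst D, Fa F \<circ> snd D)"

definition omega_cocontinuous ::
  "('o1, 'm1, 'y) cat_scheme \<Rightarrow> ('o2, 'm2, 'z) cat_scheme \<Rightarrow> ('o1, 'm1, 'o2, 'm2) fctr \<Rightarrow> bool" where
  "omega_cocontinuous C D F \<longleftrightarrow> is_functor C D F \<and>
     (\<forall>S M \<mu>. omega_diagram C S \<and> is_colimit C S M \<mu> \<longrightarrow>
        is_colimit D (map_seq F S) (Fo F M) (Fa F \<circ> \<mu>))"

text \<open>Categories with a chosen initial object and chosen colimits (vertex and cocone) of
  \<open>\<omega>\<close>-diagrams.\<close>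

record ('o, 'm) omega_cat = "('o, 'm) cat" +
  Zero :: 'o
  Colim :: "('o, 'm) seq \<Rightarrow> 'o"
  Inj :: "('o, 'm) seq \<Rightarrow> nat \<Rightarrow> 'm"

locale omega_category = category C for C :: "('o, 'm, 'z) omega_cat_scheme" (structure) +
  assumes zero_obj: "Zero C \<in> Obj C"
    and zero_initial: "A \<in> Obj C \<Longrightarrow> \<exists>!f. f \<in> hom C (Zero C) A"
    and colim: "omega_diagram C D \<Longrightarrow> is_colimit C D (Colim C D) (Inj C D)"

definition zero_arr :: "('o, 'm, 'z) omega_cat_scheme \<Rightarrow> 'o \<Rightarrow> 'm" where
  "zero_arr C A = (THE f. f \<in> hom C (Zero C) A)"

text \<open>In the following, \<open>T\<close> is a functor from \<open>A \<times> B\<close> to \<open>B\<close>.\<close>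

primrec init_obj ::
  "('o2, 'm2, 'z) omega_cat_scheme \<Rightarrow> ('o1 \<times> 'o2, 'm1 \<times> 'm2, 'o2, 'm2) fctr \<Rightarrow>
   'o1 \<Rightarrow> nat \<Rightarrow> 'o2" where
  "init_obj B T X 0 = Zero B"
| "init_obj B T X (Suc i) = Fo T (X, init_obj B T X i)"

primrec init_arr ::
  "('o1, 'm1, 'y) cat_scheme \<Rightarrow> ('o2, 'm2, 'z) omega_cat_scheme \<Rightarrow>
   ('o1 \<times> 'o2, 'm1 \<times> 'm2, 'o2, 'm2) fctr \<Rightarrow> 'o1 \<Rightarrow> nat \<Rightarrow> 'm2" where
  "init_arr A B T X 0 = zero_arr B (Fo T (X, Zero B))"
| "init_arr A B T X (Suc i) = Fa T (Idt A X, init_arr A B T X i)"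

definition init_seq ::
  "('o1, 'm1, 'y) cat_scheme \<Rightarrow> ('o2, 'm2, 'z) omega_cat_scheme \<Rightarrow>
   ('o1 \<times> 'o2, 'm1 \<times> 'm2, 'o2, 'm2) fctr \<Rightarrow> 'o1 \<Rightarrow> ('o2, 'm2) seq" where
  "init_seq A B T X = (init_obj B T X, init_arr A B T X)"

text \<open>The natural transformation between the initial sequences of \<open>T(X,-)\<close> and \<open>T(Y,-)\<close>
  that is induced by an arrow \<open>f\<close> from \<open>X\<close> to \<open>Y\<close>.\<close>

primrec init_map ::
  "('o2, 'm2, 'z) omega_cat_scheme \<Rightarrow> ('o1 \<times> 'o2, 'm1 \<times> 'm2, 'o2, 'm2) fctr \<Rightarrow>
   'm1 \<Rightarrow> nat \<Rightarrow> 'm2" where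
  "init_map B T f 0 = Idt B (Zero B)"
| "init_map B T f (Suc i) = Fa T (f, init_map B T f i)"

definition dagger_obj ::
  "('o1, 'm1, 'y) cat_scheme \<Rightarrow> ('o2, 'm2, 'z) omega_cat_scheme \<Rightarrow>
   ('o1 \<times> 'o2, 'm1 \<times> 'm2, 'o2, 'm2) fctr \<Rightarrow> 'o1 \<Rightarrow> 'o2" where
  "dagger_obj A B T X = Colim B (init_seq A B T X)"

definition dagger_arr ::
  "('o1, 'm1, 'y) cat_scheme \<Rightarrow> ('o2, 'm2, 'z) omega_cat_scheme \<Rightarrow>
   ('o1 \<times> 'o2, 'm1 \<times> 'm2, 'o2, 'm2) fctr \<Rightarrow> 'm1 \<Rightarrow> 'm2" where
  "dagger_arr A B T f =
     (let X = Dom A f; Y = Cod A f in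
      THE h. h \<in> hom B (dagger_obj A B T X) (dagger_obj A B T Y) \<and>
        (\<forall>i. h \<cdot>\<^bsub>B\<^esub> Inj B (init_seq A B T X) i =
             Inj B (init_seq A B T Y) i \<cdot>\<^bsub>B\<^esub> init_map B T f i))"

definition dagger ::
  "('o1, 'm1, 'y) cat_scheme \<Rightarrow> ('o2, 'm2, 'z) omega_cat_scheme \<Rightarrow>
   ('o1 \<times> 'o2, 'm1 \<times> 'm2, 'o2, 'm2) fctr \<Rightarrow> ('o1, 'm1, 'o2, 'm2) fctr" where
  "dagger A B T = \<lparr>Fo = dagger_obj A B T, Fa = dagger_arr A B T\<rparr>"

definition directed_in :: "'x set \<Rightarrow> ('x \<Rightarrow> 'x \<Rightarrow> bool) \<Rightarrow> 'x set \<Rightarrow> bool" where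
  "directed_in S le D \<longleftrightarrow> D \<subseteq> S \<and> D \<noteq> {} \<and> (\<forall>x\<in>D. \<forall>y\<in>D. \<exists>z\<in>D. le x z \<and> le y z)"

definition lub_in :: "'x set \<Rightarrow> ('x \<Rightarrow> 'x \<Rightarrow> bool) \<Rightarrow> 'x set \<Rightarrow> 'x \<Rightarrow> bool" where
  "lub_in S le D x \<longleftrightarrow> x \<in> S \<and> (\<forall>d\<in>D. le d x) \<and> (\<forall>y\<in>S. (\<forall>d\<in>D. le d y) \<longrightarrow> le x y)"

definition pointed_dcpo :: "'x set \<Rightarrow> ('x \<Rightarrow> 'x \<Rightarrow> bool) \<Rightarrow> 'x \<Rightarrow> bool" where
  "pointed_dcpo S le b \<longleftrightarrow>
     reflp_on S le \<and> transp_on S le \<and> antisymp_on S le \<and>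
     (\<forall>D. directed_in S le D \<longrightarrow> (\<exists>x. lub_in S le D x)) \<and>
     b \<in> S \<and> (\<forall>x\<in>S. le b x)"

definition scott_continuous ::
  "'x set \<Rightarrow> ('x \<Rightarrow> 'x \<Rightarrow> bool) \<Rightarrow> 'y set \<Rightarrow> ('y \<Rightarrow> 'y \<Rightarrow> bool) \<Rightarrow> ('x \<Rightarrow> 'y) \<Rightarrow> bool" where
  "scott_continuous S leS R leR f \<longleftrightarrow> f ` S \<subseteq> R \<and> monotone_on S leS leR f \<and>
     (\<forall>D x. directed_in S leS D \<and> lub_in S leS D x \<longrightarrow> lub_in R leR (f ` D) (f x))"

record ('o, 'm, 'a) aff_data = "('o, 'm) omega_cat" +
  Tensor :: "('o \<times> 'o, 'm \<times> 'm, 'o, 'm) fctr"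
  TensorUnit :: 'o
  Assoc :: "'o \<Rightarrow> 'o \<Rightarrow> 'o \<Rightarrow> 'm"
  LUnit :: "'o \<Rightarrow> 'm"
  RUnit :: "'o \<Rightarrow> 'm"
  Symm :: "'o \<Rightarrow> 'o \<Rightarrow> 'm"
  Sum :: "'o \<Rightarrow> 'o \<Rightarrow> 'o"
  InL :: "'o \<Rightarrow> 'o \<Rightarrow> 'm"
  InR :: "'o \<Rightarrow> 'o \<Rightarrow> 'm"
  Atom :: "'a \<Rightarrow> 'o"
  Discard :: "'a \<Rightarrow> 'm"
  Below :: "'m \<Rightarrow> 'm \<Rightarrow> bool"
  Bottom :: "'o \<Rightarrow> 'o \<Rightarrow> 'm"

abbreviation tensor_obj :: "('o, 'm, 'a, 'z) aff_data_scheme \<Rightarrow> 'o \<Rightarrow> 'o \<Rightarrow> 'o"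
  (infixr "\<otimes>\<index>" 80) where
  "A \<otimes>\<^bsub>C\<^esub> B \<equiv> Fo (Tensor C) (A, B)"

abbreviation tensor_arr :: "('o, 'm, 'a, 'z) aff_data_scheme \<Rightarrow> 'm \<Rightarrow> 'm \<Rightarrow> 'm"
  (infixr "\<odot>\<index>" 80) where
  "f \<odot>\<^bsub>C\<^esub> g \<equiv> Fa (Tensor C) (f, g)"

definition copair ::
  "('o, 'm, 'a, 'z) aff_data_scheme \<Rightarrow> 'm \<Rightarrow> 'm \<Rightarrow> 'm" where
  "copair C f g =
     (let A = Dom C f; B = Dom C g in
      THE h. h \<in> hom C (Sum C A B) (Cod C f) \<and>
        h \<cdot>\<^bsub>C\<^esub> InL C A B = f \<and> h \<cdot>\<^bsub>C\<^esub> InR C A B = g)"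

definition sum_arr ::
  "('o, 'm, 'a, 'z) aff_data_scheme \<Rightarrow> 'm \<Rightarrow> 'm \<Rightarrow> 'm" where
  "sum_arr C f g =
     copair C (InL C (Cod C f) (Cod C g) \<cdot>\<^bsub>C\<^esub> f) (InR C (Cod C f) (Cod C g) \<cdot>\<^bsub>C\<^esub> g)"

definition sum_functor ::
  "('o, 'm, 'a, 'z) aff_data_scheme \<Rightarrow> ('o \<times> 'o, 'm \<times> 'm, 'o, 'm) fctr" where
  "sum_functor C = \<lparr>Fo = (\<lambda>(A, B). Sum C A B), Fa = (\<lambda>(f, g). sum_arr C f g)\<rparr>"

locale symmetric_monoidal = category C for C :: "('o, 'm, 'a, 'z) aff_data_scheme" (structure) +
  assumes tensor_functor: "is_functor (prod_cat C C) C (Tensor C)"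
    and unit_obj: "TensorUnit C \<in> Obj C"
    and assoc_iso: "\<lbrakk>X \<in> Obj C; Y \<in> Obj C; Z \<in> Obj C\<rbrakk> \<Longrightarrow>
          iso_arr C ((X \<otimes> Y) \<otimes> Z) (X \<otimes> (Y \<otimes> Z)) (Assoc C X Y Z)"
    and lunit_iso: "X \<in> Obj C \<Longrightarrow> iso_arr C (TensorUnit C \<otimes> X) X (LUnit C X)"
    and runit_iso: "X \<in> Obj C \<Longrightarrow> iso_arr C (X \<otimes> TensorUnit C) X (RUnit C X)"
    and symm_hom: "\<lbrakk>X \<in> Obj C; Y \<in> Obj C\<rbrakk> \<Longrightarrow> Symm C X Y \<in> hom C (X \<otimes> Y) (Y \<otimes> X)"
    and assoc_natural: "\<lbrakk>f \<in> hom C X X'; g \<in> hom C Y Y'; h \<in> hom C Z Z'\<rbrakk> \<Longrightarrow>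
          Assoc C X' Y' Z' \<cdot> ((f \<odot> g) \<odot> h) = (f \<odot> (g \<odot> h)) \<cdot> Assoc C X Y Z"
    and lunit_natural: "f \<in> hom C X X' \<Longrightarrow>
          LUnit C X' \<cdot> (Idt C (TensorUnit C) \<odot> f) = f \<cdot> LUnit C X"
    and runit_natural: "f \<in> hom C X X' \<Longrightarrow>
          RUnit C X' \<cdot> (f \<odot> Idt C (TensorUnit C)) = f \<cdot> RUnit C X"
    and symm_natural: "\<lbrakk>f \<in> hom C X X'; g \<in> hom C Y Y'\<rbrakk> \<Longrightarrow>
          Symm C X' Y' \<cdot> (f \<odot> g) = (g \<odot> f) \<cdot> Symm C X Y"
    and pentagon: "\<lbrakk>W \<in> Obj C; X \<in> Obj C; Y \<in> Obj C; Z \<in> Obj C\<rbrakk> \<Longrightarrow>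
          (Idt C W \<odot> Assoc C X Y Z) \<cdot> Assoc C W (X \<otimes> Y) Z \<cdot> (Assoc C W X Y \<odot> Idt C Z)
          = Assoc C W X (Y \<otimes> Z) \<cdot> Assoc C (W \<otimes> X) Y Z"
    and triangle: "\<lbrakk>X \<in> Obj C; Y \<in> Obj C\<rbrakk> \<Longrightarrow>
          (Idt C X \<odot> LUnit C Y) \<cdot> Assoc C X (TensorUnit C) Y = RUnit C X \<odot> Idt C Y"
    and symm_involution: "\<lbrakk>X \<in> Obj C; Y \<in> Obj C\<rbrakk> \<Longrightarrow>
          Symm C Y X \<cdot> Symm C X Y = Idt C (X \<otimes> Y)"
    and symm_unit: "X \<in> Obj C \<Longrightarrow> LUnit C X \<cdot> Symm C X (TensorUnit C) = RUnit C X"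
    and hexagon: "\<lbrakk>X \<in> Obj C; Y \<in> Obj C; Z \<in> Obj C\<rbrakk> \<Longrightarrow>
          Assoc C Y Z X \<cdot> Symm C X (Y \<otimes> Z) \<cdot> Assoc C X Y Z
          = (Idt C Y \<odot> Symm C X Z) \<cdot> Assoc C Y X Z \<cdot> (Symm C X Y \<odot> Idt C Z)"

text \<open>The order \<open>Below\<close> is only meaningful within the individual hom-sets. The set
  \<open>\<A>\<close> is the set of atomic types.\<close>

locale aff_model = symmetric_monoidal C + omega_category C
  for \<A> :: "'a set" and C :: "('o, 'm, 'a, 'z) aff_data_scheme" (structure) +
  assumes sum_obj: "\<lbrakk>X \<in> Obj C; Y \<in> Obj C\<rbrakk> \<Longrightarrow> Sum C X Y \<in> Obj C"
    and inl_hom: "\<lbrakk>X \<in> Obj C; Y \<in> Obj C\<rbrakk> \<Longrightarrow> InL C X Y \<in> hom C X (Sum C X Y)"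
    and inr_hom: "\<lbrakk>X \<in> Obj C; Y \<in> Obj C\<rbrakk> \<Longrightarrow> InR C X Y \<in> hom C Y (Sum C X Y)"
    and sum_universal: "\<lbrakk>f \<in> hom C X Z; g \<in> hom C Y Z\<rbrakk> \<Longrightarrow>
          \<exists>!h. h \<in> hom C (Sum C X Y) Z \<and> h \<cdot> InL C X Y = f \<and> h \<cdot> InR C X Y = g"
    and distributive: "\<lbrakk>X \<in> Obj C; Y \<in> Obj C; Z \<in> Obj C\<rbrakk> \<Longrightarrow>
          iso_arr C (Sum C (X \<otimes> Y) (X \<otimes> Z)) (X \<otimes> Sum C Y Z)
            (copair C (Idt C X \<odot> InL C Y Z) (Idt C X \<odot> InR C Y Z))"
    and atom_obj: "a \<in> \<A> \<Longrightarrow> Atom C a \<in> Obj C"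
    and discard_hom: "a \<in> \<A> \<Longrightarrow> Discard C a \<in> hom C (Atom C a) (TensorUnit C)"
    and tensor_cocontinuous: "omega_cocontinuous (prod_cat C C) C (Tensor C)"
    and hom_dcpo: "\<lbrakk>X \<in> Obj C; Y \<in> Obj C\<rbrakk> \<Longrightarrow>
          pointed_dcpo (hom C X Y) (Below C) (Bottom C X Y)"
    and cmp_continuous: "\<lbrakk>X \<in> Obj C; Y \<in> Obj C; Z \<in> Obj C\<rbrakk> \<Longrightarrow>
          scott_continuous (hom C Y Z \<times> hom C X Y) (rel_prod (Below C) (Below C))
            (hom C X Z) (Below C) (\<lambda>(g, f). g \<cdot> f)"
    and cmp_strict_left: "\<lbrakk>f \<in> hom C X Y; Z \<in> Obj C\<rbrakk> \<Longrightarrow>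
          Bottom C Y Z \<cdot> f = Bottom C X Z"
    and cmp_strict_right: "\<lbrakk>g \<in> hom C Y Z; X \<in> Obj C\<rbrakk> \<Longrightarrow>
          g \<cdot> Bottom C X Y = Bottom C X Z"
    and tensor_continuous: "\<lbrakk>X \<in> Obj C; X' \<in> Obj C; Y \<in> Obj C; Y' \<in> Obj C\<rbrakk> \<Longrightarrow>
          scott_continuous (hom C X X' \<times> hom C Y Y') (rel_prod (Below C) (Below C))
            (hom C (X \<otimes> Y) (X' \<otimes> Y')) (Below C) (\<lambda>(f, g). f \<odot> g)"
    and sum_continuous: "\<lbrakk>X \<in> Obj C; X' \<in> Obj C; Y \<in> Obj C; Y' \<in> Obj C\<rbrakk> \<Longrightarrow>
          scott_continuous (hom C X X' \<times> hom C Y Y') (rel_prod (Below C) (Below C))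
            (hom C (Sum C X Y) (Sum C X' Y')) (Below C) (\<lambda>(f, g). sum_arr C f g)"

text \<open>An arrow of the slice category is a triple of its domain \<open>(A, \<diamond>\<^sub>A)\<close>, the underlying
  arrow, and its codomain \<open>(B, \<diamond>\<^sub>B)\<close>.\<close>

type_synonym ('o, 'm) slice_obj = "'o \<times> 'm"
type_synonym ('o, 'm) slice_arr = "('o, 'm) slice_obj \<times> 'm \<times> ('o, 'm) slice_obj"

definition forget ::
  "(('o, 'm) slice_obj, ('o, 'm) slice_arr, 'o, 'm) fctr" where
  "forget = \<lparr>Fo = fst, Fa = (\<lambda>(_, f, _). f)\<rparr>"

definition slice_colim ::
  "('o, 'm, 'a, 'z) aff_data_scheme \<Rightarrow> (('o, 'm) slice_obj, ('o, 'm) slice_arr) seq \<Rightarrow>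
   ('o, 'm) slice_obj" where
  "slice_colim C D =
     (let M = Colim C (map_seq forget D); \<mu> = Inj C (map_seq forget D) in
      (M, THE d. d \<in> hom C M (TensorUnit C) \<and> (\<forall>i. d \<cdot>\<^bsub>C\<^esub> \<mu> i = snd (fst D i))))"

definition slice_cat ::
  "('o, 'm, 'a, 'z) aff_data_scheme \<Rightarrow>
   (('o, 'm) slice_obj, ('o, 'm) slice_arr) omega_cat" where
  "slice_cat C =
     \<lparr>Obj = {(A, d). A \<in> Obj C \<and> d \<in> hom C A (TensorUnit C)},
      Arr = {((A, d), f, (B, e)) | A d f B e.
               A \<in> Obj C \<and> d \<in> hom C A (TensorUnit C) \<and>
               B \<in> Obj C \<and> e \<in> hom C B (TensorUnit C) \<and>
               f \<in> hom C A B \<and> e \<cdot>\<^bsub>C\<^esub> f = d},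
      Dom = (\<lambda>(X, f, Y). X),
      Cod = (\<lambda>(X, f, Y). Y),
      Idt = (\<lambda>X. (X, Idt C (fst X), X)),
      Cmp = (\<lambda>(_, g, Z) (X, f, _). (X, g \<cdot>\<^bsub>C\<^esub> f, Z)),
      Zero = (Zero C, zero_arr C (TensorUnit C)),
      Colim = slice_colim C,
      Inj = (\<lambda>D i. (fst D i, Inj C (map_seq forget D) i, slice_colim C D))\<rparr>"

definition slice_tensor_obj ::
  "('o, 'm, 'a, 'z) aff_data_scheme \<Rightarrow> ('o, 'm) slice_obj \<Rightarrow> ('o, 'm) slice_obj \<Rightarrow>
   ('o, 'm) slice_obj" where
  "slice_tensor_obj C X Y =
     (fst X \<otimes>\<^bsub>C\<^esub> fst Y, LUnit C (TensorUnit C) \<cdot>\<^bsub>C\<^esub> (snd X \<odot>\<^bsub>C\<^esub> snd Y))"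

definition slice_tensor ::
  "('o, 'm, 'a, 'z) aff_data_scheme \<Rightarrow>
   (('o, 'm) slice_obj \<times> ('o, 'm) slice_obj, ('o, 'm) slice_arr \<times> ('o, 'm) slice_arr,
    ('o, 'm) slice_obj, ('o, 'm) slice_arr) fctr" where
  "slice_tensor C =
     \<lparr>Fo = (\<lambda>(X, Y). slice_tensor_obj C X Y),
      Fa = (\<lambda>((X, f, X'), (Y, g, Y')).
              (slice_tensor_obj C X Y, f \<odot>\<^bsub>C\<^esub> g, slice_tensor_obj C X' Y'))\<rparr>"

definition slice_sum_obj ::
  "('o, 'm, 'a, 'z) aff_data_scheme \<Rightarrow> ('o, 'm) slice_obj \<Rightarrow> ('o, 'm) slice_obj \<Rightarrow>
   ('o, 'm) slice_obj" where
  "slice_sum_obj C X Y = (Sum C (fst X) (fst Y), copair C (snd X) (snd Y))"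

definition slice_sum ::
  "('o, 'm, 'a, 'z) aff_data_scheme \<Rightarrow>
   (('o, 'm) slice_obj \<times> ('o, 'm) slice_obj, ('o, 'm) slice_arr \<times> ('o, 'm) slice_arr,
    ('o, 'm) slice_obj, ('o, 'm) slice_arr) fctr" where
  "slice_sum C =
     \<lparr>Fo = (\<lambda>(X, Y). slice_sum_obj C X Y),
      Fa = (\<lambda>((X, f, X'), (Y, g, Y')).
              (slice_sum_obj C X Y, sum_arr C f g, slice_sum_obj C X' Y'))\<rparr>"

text \<open>The clauses are common to both interpretations: \<open>B\<close> is the category, and \<open>u\<close>, \<open>at\<close>,
  \<open>S\<close>, \<open>P\<close> interpret the unit type, the atomic types, \<open>+\<close> and \<open>\<otimes>\<close>, respectively.\<close>

primrec interp ::
  "('o, 'm, 'z) omega_cat_scheme \<Rightarrow> 'o \<Rightarrow> ('a \<Rightarrow> 'o) \<Rightarrow>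
   ('o \<times> 'o, 'm \<times> 'm, 'o, 'm) fctr \<Rightarrow> ('o \<times> 'o, 'm \<times> 'm, 'o, 'm) fctr \<Rightarrow>
   ('a, 'v) ty \<Rightarrow> 'v list \<Rightarrow> ('o list, 'm list, 'o, 'm) fctr" where
  "interp B u at S P (TVar X) \<Theta> = fproj (THE i. i < length \<Theta> \<and> \<Theta> ! i = X)"
| "interp B u at S P TUnit \<Theta> = fconst B u"
| "interp B u at S P (TAtom a) \<Theta> = fconst B (at a)"
| "interp B u at S P (TSum A A') \<Theta> =
     S \<circ>\<^sub>F ftuple (interp B u at S P A \<Theta>) (interp B u at S P A' \<Theta>)"
| "interp B u at S P (TTensor A A') \<Theta> =
     P \<circ>\<^sub>F ftuple (interp B u at S P A \<Theta>) (interp B u at S P A' \<Theta>)"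
| "interp B u at S P (TMu X A) \<Theta> =
     dagger (power_cat B (length \<Theta>)) B (interp B u at S P A (\<Theta> @ [X]) \<circ>\<^sub>F snoc)"

definition std_interp ::
  "('o, 'm, 'a, 'z) aff_data_scheme \<Rightarrow> 'v list \<Rightarrow> ('a, 'v) ty \<Rightarrow>
   ('o list, 'm list, 'o, 'm) fctr" where
  "std_interp C \<Theta> A =
     interp C (TensorUnit C) (Atom C) (sum_functor C) (Tensor C) A \<Theta>"

definition aff_interp ::
  "('o, 'm, 'a, 'z) aff_data_scheme \<Rightarrow> 'v list \<Rightarrow> ('a, 'v) ty \<Rightarrow>
   (('o, 'm) slice_obj list, ('o, 'm) slice_arr list,
    ('o, 'm) slice_obj, ('o, 'm) slice_arr) fctr" where
  "aff_interp C \<Theta> A =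
     interp (slice_cat C) (TensorUnit C, Idt C (TensorUnit C))
       (\<lambda>a. (Atom C a, Discard C a)) (slice_sum C) (slice_tensor C) A \<Theta>"

definition std_interp_closed :: "('o, 'm, 'a, 'z) aff_data_scheme \<Rightarrow> ('a, 'v) ty \<Rightarrow> 'o" where
  "std_interp_closed C A = Fo (std_interp C [] A) []"

definition aff_interp_closed ::
  "('o, 'm, 'a, 'z) aff_data_scheme \<Rightarrow> ('a, 'v) ty \<Rightarrow> ('o, 'm) slice_obj" where
  "aff_interp_closed C A = Fo (aff_interp C [] A) []"

end

theory Submission
  imports Defs
begin

text \<open>The forgetful functor from the slice category preserves the chosen initial object and the
  chosen colimits of \<open>\<omega>\<close>-diagrams on the nose, and it commutes strictly with \<open>+\<close>, \<open>\<otimes>\<close> and the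
  constants. If such a strict functor intertwines two functors \<open>T'\<close> and \<open>T\<close>, then it maps the
  initial sequence of \<open>T'\<close> to that of \<open>T\<close>, hence the chosen colimit to the chosen colimit, and the
  induced arrows agree by uniqueness; so it commutes with \<open>(-)\<^sup>\<dagger>\<close> and, by induction, with the
  interpretation of every type.\<close>

section \<open>Functors\<close>

text \<open>Equality on the nose, rather than up to isomorphism, shapes the argument. Colimits are
  values of a choice function, and isomorphic diagrams may have different chosen colimits; hence the
  initial sequences have to coincide as functions before their colimits can be compared. Arrows
  between colimits are definite descriptions, meaningful only once unique existence is known, so
  each interpretation is shown to be functorial in its own category before arrows are compared;
  \<open>functor_eq\<close> asks for functoriality of both sides anyway. The chosen colimits of the
  slice are built from those of the base, with an arrow to the unit supplied by the universal
  property; that they are genuine colimits of the slice is the point that needs proof. Both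
  interpretations are treated at once: \<open>interp\<close> is studied over arbitrary data, and the
  comparison over an arbitrary strict functor between two such sets of data.\<close>

lemma is_functorI:
  assumes "\<And>A. A \<in> Obj C \<Longrightarrow> Fo F A \<in> Obj D"
    and "\<And>A. A \<in> Obj C \<Longrightarrow> Fa F (Idt C A) = Idt D (Fo F A)"
    and "\<And>A B f. f \<in> hom C A B \<Longrightarrow> Fa F f \<in> hom D (Fo F A) (Fo F B)"
    and "\<And>A B E f g. f \<in> hom C A B \<Longrightarrow> g \<in> hom C B E \<Longrightarrow>
           Fa F (g \<cdot>\<^bsub>C\<^esub> f) = Fa F g \<cdot>\<^bsub>D\<^esub> Fa F f"
  shows "is_functor C D F"
  using assms unfolding is_functor_def by blast

lemma functor_obj: "is_functor C D F \<Longrightarrow> A \<in> Obj C \<Longrightarrow> Fo F A \<in> Obj D"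
  and functor_idt: "is_functor C D F \<Longrightarrow> A \<in> Obj C \<Longrightarrow> Fa F (Idt C A) = Idt D (Fo F A)"
  and functor_hom: "is_functor C D F \<Longrightarrow> f \<in> hom C A B \<Longrightarrow> Fa F f \<in> hom D (Fo F A) (Fo F B)"
  and functor_cmp: "is_functor C D F \<Longrightarrow> f \<in> hom C A B \<Longrightarrow> g \<in> hom C B E \<Longrightarrow>
         Fa F (g \<cdot>\<^bsub>C\<^esub> f) = Fa F g \<cdot>\<^bsub>D\<^esub> Fa F f"
  unfolding is_functor_def by blast+

lemma homD: "f \<in> hom C A B \<Longrightarrow> f \<in> Arr C \<and> Dom C f = A \<and> Cod C f = B"
  by (simp add: hom_def)

lemma Arr_hom: "f \<in> Arr C \<Longrightarrow> f \<in> hom C (Dom C f) (Cod C f)"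
  by (simp add: hom_def)

lemma (in category) hom_obj: "f \<in> hom C A B \<Longrightarrow> A \<in> Obj C \<and> B \<in> Obj C"
  using dom_obj cod_obj by (auto simp: hom_def)

lemma functor_arr: "is_functor C D F \<Longrightarrow> f \<in> Arr C \<Longrightarrow> Fa F f \<in> Arr D"
  by (meson Arr_hom functor_hom homD)

lemma fcomp_functor:
  "is_functor C D F \<Longrightarrow> is_functor D E G \<Longrightarrow> is_functor C E (G \<circ>\<^sub>F F)"
  by (rule is_functorI)
     (auto simp: fcomp_def functor_obj functor_idt intro: functor_hom,
      metis functor_cmp functor_hom)

lemma hom_prod_cat:
  "hom (prod_cat C D) (A, B) (A', B') = hom C A A' \<times> hom D B B'"
  by (auto simp: hom_def prod_cat_def)

lemma cmp_prod_cat: "(g, g') \<cdot>\<^bsub>prod_cat C D\<^esub> (f, f') = (g \<cdot>\<^bsub>C\<^esub> f, g' \<cdot>\<^bsub>D\<^esub> f')"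
  by (simp add: prod_cat_def)

lemma idt_prod_cat: "Idt (prod_cat C D) (A, B) = (Idt C A, Idt D B)"
  by (simp add: prod_cat_def)

lemma obj_prod_cat: "Obj (prod_cat C D) = Obj C \<times> Obj D"
  by (simp add: prod_cat_def)

lemma arr_prod_cat: "Arr (prod_cat C D) = Arr C \<times> Arr D"
  by (simp add: prod_cat_def)

lemmas prod_cat_simps = hom_prod_cat cmp_prod_cat idt_prod_cat obj_prod_cat arr_prod_cat

lemma ftuple_functor:
  assumes "is_functor C D F" "is_functor C E G"
  shows "is_functor C (prod_cat D E) (ftuple F G)"
  using assms
  by (intro is_functorI)
     (auto simp: ftuple_def prod_cat_simps functor_obj functor_idt functor_cmp intro: functor_hom)

lemma (in category) fconst_functor: "X \<in> Obj C \<Longrightarrow> is_functor D C (fconst C X)"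
  by (intro is_functorI) (auto simp: fconst_def idt_hom idt_left[OF idt_hom])

section \<open>Powers of a category\<close>

lemma obj_power_cat: "Obj (power_cat C n) = {As. length As = n \<and> set As \<subseteq> Obj C}"
  and arr_power_cat: "Arr (power_cat C n) = {fs. length fs = n \<and> set fs \<subseteq> Arr C}"
  and idt_power_cat: "Idt (power_cat C n) As = map (Idt C) As"
  and cmp_power_cat: "gs \<cdot>\<^bsub>power_cat C n\<^esub> fs = map2 (Cmp C) gs fs"
  by (simp_all add: power_cat_def)

text \<open>Turns statements about lists into statements about components, so that the laws of the
  power follow index by index. The lengths of the endpoints appear because \<open>map\<close>
  transfers the length of the list of arrows to its domain and codomain.\<close>

lemma hom_power_cat:
  "fs \<in> hom (power_cat C n) As Bs \<longleftrightarrow>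
     length fs = n \<and> length As = n \<and> length Bs = n \<and> (\<forall>i<n. fs ! i \<in> hom C (As ! i) (Bs ! i))"
  unfolding hom_def power_cat_def
  by (auto simp: subset_iff in_set_conv_nth list_eq_iff_nth_eq)

lemmas power_cat_simps = obj_power_cat arr_power_cat idt_power_cat cmp_power_cat hom_power_cat

lemma power_category:
  assumes "category C"
  shows "category (power_cat C n)"
proof -
  interpret category C by fact
  show ?thesis
  proof
    fix f assume "f \<in> Arr (power_cat C n)"
    then show "Dom (power_cat C n) f \<in> Obj (power_cat C n)"
      and "Cod (power_cat C n) f \<in> Obj (power_cat C n)"
      by (auto simp: power_cat_def dom_obj cod_obj subset_iff)
  next
    fix A assume "A \<in> Obj (power_cat C n)"
    then show "Idt (power_cat C n) A \<in> hom (power_cat C n) A A"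
      by (auto simp: power_cat_simps idt_hom subset_iff)
  next
    fix f g A B D assume "f \<in> hom (power_cat C n) A B" "g \<in> hom (power_cat C n) B D"
    then show "g \<cdot>\<^bsub>power_cat C n\<^esub> f \<in> hom (power_cat C n) A D"
      by (auto simp: power_cat_simps intro: cmp_hom)
  next
    fix f A B assume "f \<in> hom (power_cat C n) A B"
    then show "Idt (power_cat C n) B \<cdot>\<^bsub>power_cat C n\<^esub> f = f"
      and "f \<cdot>\<^bsub>power_cat C n\<^esub> Idt (power_cat C n) A = f"
      by (auto simp: power_cat_simps intro!: nth_equalityI idt_left idt_right)
  next
    fix f g h A B D E
    assume "f \<in> hom (power_cat C n) A B" "g \<in> hom (power_cat C n) B D"
      "h \<in> hom (power_cat C n) D E"
    then show "(h \<cdot>\<^bsub>power_cat C n\<^esub> g) \<cdot>\<^bsub>power_cat C n\<^esub> f =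
               h \<cdot>\<^bsub>power_cat C n\<^esub> (g \<cdot>\<^bsub>power_cat C n\<^esub> f)"
      by (auto simp: power_cat_simps intro!: nth_equalityI cmp_assoc)
  qed
qed

lemma fproj_functor: "i < n \<Longrightarrow> is_functor (power_cat C n) C (fproj i)"
  by (rule is_functorI) (auto simp: fproj_def power_cat_simps subset_iff)

lemma fpower_functor:
  assumes "is_functor C D F"
  shows "is_functor (power_cat C n) (power_cat D n) (fpower F)"
proof (rule is_functorI)
  fix As Bs Es fs gs
  assume "fs \<in> hom (power_cat C n) As Bs" "gs \<in> hom (power_cat C n) Bs Es"
  then show "Fa (fpower F) (gs \<cdot>\<^bsub>power_cat C n\<^esub> fs) =
      Fa (fpower F) gs \<cdot>\<^bsub>power_cat D n\<^esub> Fa (fpower F) fs"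
    using functor_cmp[OF assms]
    by (auto simp: fpower_def power_cat_simps intro!: nth_equalityI) blast
qed (use assms in \<open>auto simp: fpower_def power_cat_simps subset_iff functor_obj functor_idt
       intro: functor_hom\<close>)

text \<open>Through this functor an interpretation with \<open>n + 1\<close> arguments becomes a
  functor of a parameter list and one recursion variable, the shape that \<open>dagger\<close>
  expects.\<close>

lemma snoc_functor:
  "is_functor (prod_cat (power_cat C n) C) (power_cat C (Suc n)) snoc"
  by (rule is_functorI)
     (auto simp: snoc_def prod_cat_simps power_cat_simps nth_append less_Suc_eq)

section \<open>Parameterised initial algebras\<close>

lemma (in omega_category) zero_arr_hom: "A \<in> Obj C \<Longrightarrow> zero_arr C A \<in> hom C (Zero C) A"
  unfolding zero_arr_def using zero_initial by (rule theI')

lemma (in omega_category) zero_arr_unique: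
  "A \<in> Obj C \<Longrightarrow> f \<in> hom C (Zero C) A \<Longrightarrow> g \<in> hom C (Zero C) A \<Longrightarrow> f = g"
  using zero_initial by blast

text \<open>The setting for a single recursion: \<open>A\<close> holds the parameters and
  \<open>B\<close> the recursion variable, so the chosen colimits belong to \<open>B\<close>. For
  types, \<open>A\<close> is a power of \<open>B\<close>.\<close>

locale parameterised = A: category A + B: omega_category B
  for A :: "('o1, 'm1, 'y) cat_scheme" and B :: "('o2, 'm2, 'z) omega_cat_scheme" +
  fixes T :: "('o1 \<times> 'o2, 'm1 \<times> 'm2, 'o2, 'm2) fctr"
  assumes T: "is_functor (prod_cat A B) B T"
begin

lemma T_obj: "X \<in> Obj A \<Longrightarrow> Y \<in> Obj B \<Longrightarrow> Fo T (X, Y) \<in> Obj B"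
  using functor_obj[OF T, of "(X, Y)"] by (simp add: prod_cat_simps)

lemma T_idt: "X \<in> Obj A \<Longrightarrow> Y \<in> Obj B \<Longrightarrow> Fa T (Idt A X, Idt B Y) = Idt B (Fo T (X, Y))"
  using functor_idt[OF T, of "(X, Y)"] by (simp add: prod_cat_simps)

lemma T_hom:
  "f \<in> hom A X X' \<Longrightarrow> g \<in> hom B Y Y' \<Longrightarrow> Fa T (f, g) \<in> hom B (Fo T (X, Y)) (Fo T (X', Y'))"
  using functor_hom[OF T, of "(f, g)" "(X, Y)" "(X', Y')"] by (simp add: prod_cat_simps)

lemma T_cmp:
  assumes "f \<in> hom A X X'" "f' \<in> hom A X' X''" "g \<in> hom B Y Y'" "g' \<in> hom B Y' Y''"
  shows "Fa T (f', g') \<cdot>\<^bsub>B\<^esub> Fa T (f, g) = Fa T (f' \<cdot>\<^bsub>A\<^esub> f, g' \<cdot>\<^bsub>B\<^esub> g)"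
  using functor_cmp[OF T, of "(f, g)" "(X, Y)" "(X', Y')" "(f', g')" "(X'', Y'')"] assms
  by (simp add: prod_cat_simps)

section \<open>The initial sequence and the maps between initial sequences\<close>

lemma init_obj_obj: "X \<in> Obj A \<Longrightarrow> init_obj B T X i \<in> Obj B"
  by (induction i) (simp_all add: T_obj B.zero_obj)

lemma init_arr_hom:
  "X \<in> Obj A \<Longrightarrow> init_arr A B T X i \<in> hom B (init_obj B T X i) (init_obj B T X (Suc i))"
  by (induction i) (auto simp: T_obj B.zero_obj intro: B.zero_arr_hom T_hom A.idt_hom)

lemma init_seq_diagram: "X \<in> Obj A \<Longrightarrow> omega_diagram B (init_seq A B T X)"
  using init_obj_obj init_arr_hom by (simp add: omega_diagram_def init_seq_def)

lemma init_map_hom: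
  "f \<in> hom A X Y \<Longrightarrow> init_map B T f i \<in> hom B (init_obj B T X i) (init_obj B T Y i)"
  by (induction i) (auto intro: T_hom B.idt_hom B.zero_obj)

lemma init_map_natural:
  assumes f: "f \<in> hom A X Y"
  shows "init_map B T f (Suc i) \<cdot>\<^bsub>B\<^esub> init_arr A B T X i =
         init_arr A B T Y i \<cdot>\<^bsub>B\<^esub> init_map B T f i"
proof (induction i)
  case 0
  have XY: "X \<in> Obj A" "Y \<in> Obj A"
    using f A.hom_obj by auto
  show ?case
  \<comment> \<open>Both composites start at the initial object, so only their typing has to be
    checked.\<close>
  proof (rule B.zero_arr_unique)
    show "init_obj B T Y (Suc 0) \<in> Obj B"
      using XY init_obj_obj by blast
    show "init_map B T f (Suc 0) \<cdot>\<^bsub>B\<^esub> init_arr A B T X 0 \<in> hom B (Zero B) (init_obj B T Y (Suc 0))"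
      using B.cmp_hom[OF init_arr_hom[OF XY(1), of 0] init_map_hom[OF f, of "Suc 0"]] by simp
    show "init_arr A B T Y 0 \<cdot>\<^bsub>B\<^esub> init_map B T f 0 \<in> hom B (Zero B) (init_obj B T Y (Suc 0))"
      using B.cmp_hom[OF init_map_hom[OF f, of 0] init_arr_hom[OF XY(2), of 0]] by simp
  qed
next
  case (Suc i)
  have XY: "X \<in> Obj A" "Y \<in> Obj A"
    using f A.hom_obj by auto
  show ?case
    \<comment> \<open>Both sides are images under \<open>T\<close> of pairs. In the parameter
      component \<open>f\<close> is composed with an identity on one side or the other; in the
      recursion component the two composites agree by the induction hypothesis.\<close>
    using Suc T_cmp[OF A.idt_hom[OF XY(1)] f init_arr_hom[OF XY(1)] init_map_hom[OF f]]
      T_cmp[OF f A.idt_hom[OF XY(2)] init_map_hom[OF f] init_arr_hom[OF XY(2)]]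
    by (simp add: A.idt_left[OF f] A.idt_right[OF f])
qed

lemma init_map_idt: "X \<in> Obj A \<Longrightarrow> init_map B T (Idt A X) i = Idt B (init_obj B T X i)"
  by (induction i) (simp_all add: T_idt init_obj_obj)

lemma init_map_cmp:
  assumes "f \<in> hom A X Y" "g \<in> hom A Y Z"
  shows "init_map B T (g \<cdot>\<^bsub>A\<^esub> f) i = init_map B T g i \<cdot>\<^bsub>B\<^esub> init_map B T f i"
proof (induction i)
  case 0
  show ?case
    by (simp add: B.idt_left[OF B.idt_hom] B.zero_obj)
next
  case (Suc i)
  then show ?case
    using T_cmp[OF assms init_map_hom[OF assms(1)] init_map_hom[OF assms(2)]] by simp
qed

section \<open>The chosen colimit of the initial sequence and the induced arrows\<close>

lemma dagger_colimit:
  "X \<in> Obj A \<Longrightarrow>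
     is_colimit B (init_seq A B T X) (dagger_obj A B T X) (Inj B (init_seq A B T X))"
  unfolding dagger_obj_def by (intro B.colim init_seq_diagram)

lemma dagger_obj_obj: "X \<in> Obj A \<Longrightarrow> dagger_obj A B T X \<in> Obj B"
  using dagger_colimit by (simp add: is_colimit_def is_cocone_def)

lemma inj_hom:
  "X \<in> Obj A \<Longrightarrow>
     Inj B (init_seq A B T X) i \<in> hom B (init_obj B T X i) (dagger_obj A B T X)"
  using dagger_colimit[of X] by (simp add: is_colimit_def is_cocone_def init_seq_def)

lemma inj_natural:
  "X \<in> Obj A \<Longrightarrow>
     Inj B (init_seq A B T X) (Suc i) \<cdot>\<^bsub>B\<^esub> init_arr A B T X i = Inj B (init_seq A B T X) i"
  using dagger_colimit[of X] by (simp add: is_colimit_def is_cocone_def init_seq_def)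

text \<open>The legs of the colimit at \<open>Y\<close>, precomposed with the maps between the
  initial sequences, form a cocone on the sequence at \<open>X\<close> by naturality. This is the
  fact that gives the description in \<open>dagger_arr\<close> its meaning.\<close>

lemma dagger_arr_ex1:
  assumes f: "f \<in> hom A X Y"
  shows "\<exists>!h. h \<in> hom B (dagger_obj A B T X) (dagger_obj A B T Y) \<and>
     (\<forall>i. h \<cdot>\<^bsub>B\<^esub> Inj B (init_seq A B T X) i = Inj B (init_seq A B T Y) i \<cdot>\<^bsub>B\<^esub> init_map B T f i)"
proof -
  have XY: "X \<in> Obj A" "Y \<in> Obj A"
    using f A.hom_obj by auto
  let ?\<nu> = "\<lambda>i. Inj B (init_seq A B T Y) i \<cdot>\<^bsub>B\<^esub> init_map B T f i"
  have "is_cocone B (init_seq A B T X) (dagger_obj A B T Y) ?\<nu>"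
    unfolding is_cocone_def
  proof (intro conjI allI)
    show "dagger_obj A B T Y \<in> Obj B"
      by (rule dagger_obj_obj[OF XY(2)])
    fix i
    show "?\<nu> i \<in> hom B (fst (init_seq A B T X) i) (dagger_obj A B T Y)"
      using B.cmp_hom[OF init_map_hom[OF f] inj_hom[OF XY(2)]] by (simp add: init_seq_def)
    have "?\<nu> (Suc i) \<cdot>\<^bsub>B\<^esub> init_arr A B T X i =
        Inj B (init_seq A B T Y) (Suc i) \<cdot>\<^bsub>B\<^esub> (init_map B T f (Suc i) \<cdot>\<^bsub>B\<^esub> init_arr A B T X i)"
      by (rule B.cmp_assoc[OF init_arr_hom[OF XY(1)] init_map_hom[OF f] inj_hom[OF XY(2)]])
    also have "\<dots> = Inj B (init_seq A B T Y) (Suc i) \<cdot>\<^bsub>B\<^esub> (init_arr A B T Y i \<cdot>\<^bsub>B\<^esub> init_map B T f i)"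
      by (simp only: init_map_natural[OF f])
    also have "\<dots> = (Inj B (init_seq A B T Y) (Suc i) \<cdot>\<^bsub>B\<^esub> init_arr A B T Y i) \<cdot>\<^bsub>B\<^esub> init_map B T f i"
      by (rule B.cmp_assoc[OF init_map_hom[OF f] init_arr_hom[OF XY(2)] inj_hom[OF XY(2)], symmetric])
    also have "\<dots> = ?\<nu> i"
      by (simp only: inj_natural[OF XY(2)])
    finally show "?\<nu> (Suc i) \<cdot>\<^bsub>B\<^esub> snd (init_seq A B T X) i = ?\<nu> i"
      by (simp add: init_seq_def)
  qed
  then show ?thesis
    using dagger_colimit[OF XY(1)] unfolding is_colimit_def by blast
qed

lemma dagger_arr_hom:
  "f \<in> hom A X Y \<Longrightarrow> dagger_arr A B T f \<in> hom B (dagger_obj A B T X) (dagger_obj A B T Y)"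
  and dagger_arr_inj:
  "f \<in> hom A X Y \<Longrightarrow> dagger_arr A B T f \<cdot>\<^bsub>B\<^esub> Inj B (init_seq A B T X) i =
     Inj B (init_seq A B T Y) i \<cdot>\<^bsub>B\<^esub> init_map B T f i"
  using theI'[OF dagger_arr_ex1, of f X Y] homD[of f A X Y]
  by (simp_all add: dagger_arr_def Let_def)

text \<open>Uniqueness in the form in which it is applied: preservation of identities, preservation
  of composition and the comparison along a strict functor all verify the equations on the legs for
  a candidate \<open>h\<close>.\<close>

lemma dagger_arr_eqI:
  assumes "f \<in> hom A X Y" "h \<in> hom B (dagger_obj A B T X) (dagger_obj A B T Y)"
    and "\<And>i. h \<cdot>\<^bsub>B\<^esub> Inj B (init_seq A B T X) i =
           Inj B (init_seq A B T Y) i \<cdot>\<^bsub>B\<^esub> init_map B T f i"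
  shows "dagger_arr A B T f = h"
  using assms dagger_arr_ex1[OF assms(1)] dagger_arr_hom[OF assms(1)] dagger_arr_inj[OF assms(1)]
  by blast

lemma dagger_functor: "is_functor A B (dagger A B T)"
proof (rule is_functorI)
  fix X assume X: "X \<in> Obj A"
  then show "Fo (dagger A B T) X \<in> Obj B"
    by (simp add: dagger_def dagger_obj_obj)
  have "dagger_arr A B T (Idt A X) = Idt B (dagger_obj A B T X)"
    using B.idt_left[OF inj_hom[OF X]] B.idt_right[OF inj_hom[OF X]]
    by (intro dagger_arr_eqI[OF A.idt_hom[OF X] B.idt_hom[OF dagger_obj_obj[OF X]]])
       (simp add: init_map_idt[OF X])
  then show "Fa (dagger A B T) (Idt A X) = Idt B (Fo (dagger A B T) X)"
    by (simp add: dagger_def)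
next
  fix X Y f assume "f \<in> hom A X Y"
  then show "Fa (dagger A B T) f \<in> hom B (Fo (dagger A B T) X) (Fo (dagger A B T) Y)"
    by (simp add: dagger_def dagger_arr_hom)
next
  fix X Y Z f g assume f: "f \<in> hom A X Y" and g: "g \<in> hom A Y Z"
  have obj: "X \<in> Obj A" "Y \<in> Obj A" "Z \<in> Obj A"
    using f g A.hom_obj by auto
  let ?f = "dagger_arr A B T f" and ?g = "dagger_arr A B T g"
  have "dagger_arr A B T (g \<cdot>\<^bsub>A\<^esub> f) = ?g \<cdot>\<^bsub>B\<^esub> ?f"
  proof (rule dagger_arr_eqI[OF A.cmp_hom[OF f g]
        B.cmp_hom[OF dagger_arr_hom[OF f] dagger_arr_hom[OF g]]])
    fix i
    let ?X = "Inj B (init_seq A B T X) i" and ?Y = "Inj B (init_seq A B T Y) i"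
      and ?Z = "Inj B (init_seq A B T Z) i"
    \<comment> \<open>The two defining squares are pasted along the leg at \<open>Y\<close>; the
      maps between the sequences then compose by \<open>init_map_cmp\<close>.\<close>
    have "(?g \<cdot>\<^bsub>B\<^esub> ?f) \<cdot>\<^bsub>B\<^esub> ?X = ?g \<cdot>\<^bsub>B\<^esub> (?f \<cdot>\<^bsub>B\<^esub> ?X)"
      by (rule B.cmp_assoc[OF inj_hom[OF obj(1)] dagger_arr_hom[OF f] dagger_arr_hom[OF g]])
    also have "\<dots> = (?g \<cdot>\<^bsub>B\<^esub> ?Y) \<cdot>\<^bsub>B\<^esub> init_map B T f i"
      by (simp only: dagger_arr_inj[OF f]
            B.cmp_assoc[OF init_map_hom[OF f] inj_hom[OF obj(2)] dagger_arr_hom[OF g]])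
    also have "\<dots> = ?Z \<cdot>\<^bsub>B\<^esub> init_map B T (g \<cdot>\<^bsub>A\<^esub> f) i"
      by (simp only: dagger_arr_inj[OF g] init_map_cmp[OF f g]
            B.cmp_assoc[OF init_map_hom[OF f] init_map_hom[OF g] inj_hom[OF obj(3)]])
    finally show "(?g \<cdot>\<^bsub>B\<^esub> ?f) \<cdot>\<^bsub>B\<^esub> ?X = ?Z \<cdot>\<^bsub>B\<^esub> init_map B T (g \<cdot>\<^bsub>A\<^esub> f) i" .
  qed
  then show "Fa (dagger A B T) (g \<cdot>\<^bsub>A\<^esub> f) = Fa (dagger A B T) g \<cdot>\<^bsub>B\<^esub> Fa (dagger A B T) f"
    by (simp add: dagger_def)
qed

end

section \<open>Functors that preserve the chosen colimits on the nose\<close>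

text \<open>The legs are included along with the vertex because the arrows of \<open>dagger\<close>
  are characterised by their composites with the legs. Preservation of the arrows out of the initial
  object follows from initiality in \<open>D\<close>.\<close>

definition strict_omega_functor ::
  "('o1, 'm1, 'y) omega_cat_scheme \<Rightarrow> ('o2, 'm2, 'z) omega_cat_scheme \<Rightarrow>
   ('o1, 'm1, 'o2, 'm2) fctr \<Rightarrow> bool" where
  "strict_omega_functor C D F \<longleftrightarrow> is_functor C D F \<and> Fo F (Zero C) = Zero D \<and>
     (\<forall>S. omega_diagram C S \<longrightarrow> Fo F (Colim C S) = Colim D (map_seq F S) \<and>
        (\<forall>i. Fa F (Inj C S i) = Inj D (map_seq F S) i))"

text \<open>Primed data lie on the side where \<open>U\<close> and \<open>V\<close> start. The
  parameters have a functor \<open>V\<close> of their own because they form a power, on which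
  \<open>U\<close> acts entrywise.\<close>

locale parameterised_morphism =
  source: parameterised A' B' T' + target: parameterised A B T
  for A' :: "('o1, 'm1, 'y) cat_scheme" and B' :: "('o2, 'm2, 'z) omega_cat_scheme"
    and T' :: "('o1 \<times> 'o2, 'm1 \<times> 'm2, 'o2, 'm2) fctr"
    and A :: "('o3, 'm3, 'w) cat_scheme" and B :: "('o4, 'm4, 'x) omega_cat_scheme"
    and T :: "('o3 \<times> 'o4, 'm3 \<times> 'm4, 'o4, 'm4) fctr" +
  fixes V :: "('o1, 'm1, 'o3, 'm3) fctr" and U :: "('o2, 'm2, 'o4, 'm4) fctr"
  assumes V: "is_functor A' A V"
    and U_strict: "strict_omega_functor B' B U"
    and square_obj: "X \<in> Obj A' \<Longrightarrow> Y \<in> Obj B' \<Longrightarrow> Fo T (Fo V X, Fo U Y) = Fo U (Fo T' (X, Y))"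
    and square_arr: "f \<in> Arr A' \<Longrightarrow> g \<in> Arr B' \<Longrightarrow> Fa T (Fa V f, Fa U g) = Fa U (Fa T' (f, g))"
begin

lemma U: "is_functor B' B U"
  using U_strict by (simp add: strict_omega_functor_def)

lemma U_zero: "Fo U (Zero B') = Zero B"
  using U_strict by (simp add: strict_omega_functor_def)

lemma U_colim: "omega_diagram B' S \<Longrightarrow> Fo U (Colim B' S) = Colim B (map_seq U S)"
  and U_inj: "omega_diagram B' S \<Longrightarrow> Fa U (Inj B' S i) = Inj B (map_seq U S) i"
  using U_strict unfolding strict_omega_functor_def by blast+

text \<open>Since \<open>U\<close> sends the chosen initial object to the chosen initial object, the
  image is an arrow out of \<open>Zero B\<close>, of which there is only one.\<close>

lemma U_zero_arr:
  assumes "Y \<in> Obj B'"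
  shows "Fa U (zero_arr B' Y) = zero_arr B (Fo U Y)"
  using target.B.zero_arr_unique target.B.zero_arr_hom functor_obj[OF U assms]
    functor_hom[OF U source.B.zero_arr_hom[OF assms]] U_zero
  by metis

lemma init_obj_commute:
  "X \<in> Obj A' \<Longrightarrow> init_obj B T (Fo V X) i = Fo U (init_obj B' T' X i)"
  by (induction i) (simp_all add: U_zero square_obj source.init_obj_obj)

lemma init_arr_commute:
  assumes X: "X \<in> Obj A'"
  shows "init_arr A B T (Fo V X) i = Fa U (init_arr A' B' T' X i)"
proof (induction i)
  case 0
  show ?case
    using square_obj[OF X source.B.zero_obj]
    by (simp add: U_zero U_zero_arr source.T_obj[OF X source.B.zero_obj])
next
  case (Suc i)
  \<comment> \<open>In a successor arrow the parameter component is an identity; \<open>V\<close>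
    preserves it, which brings the pair into the form required by \<open>square_arr\<close>.\<close>
  then show ?case
    using square_arr[of "Idt A' X" "init_arr A' B' T' X i"] homD[OF source.init_arr_hom[OF X]]
      homD[OF source.A.idt_hom[OF X]]
    by (simp add: functor_idt[OF V X, symmetric])
qed

text \<open>An equality of pairs of functions on all indices, so both sides are the same argument of
  \<open>Colim\<close> and \<open>Inj\<close>; an isomorphism of diagrams would not identify the
  chosen colimits.\<close>

lemma init_seq_commute:
  "X \<in> Obj A' \<Longrightarrow> init_seq A B T (Fo V X) = map_seq U (init_seq A' B' T' X)"
  by (auto simp: init_seq_def map_seq_def init_obj_commute init_arr_commute)

lemma init_map_commute:
  assumes f: "f \<in> hom A' X Y"
  shows "init_map B T (Fa V f) i = Fa U (init_map B' T' f i)"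
proof (induction i)
  case 0
  show ?case
    by (simp add: functor_idt[OF U source.B.zero_obj] U_zero)
next
  case (Suc i)
  then show ?case
    using square_arr homD[OF f] homD[OF source.init_map_hom[OF f]] by simp
qed

lemma dagger_obj_commute:
  "X \<in> Obj A' \<Longrightarrow> dagger_obj A B T (Fo V X) = Fo U (dagger_obj A' B' T' X)"
  by (simp add: dagger_obj_def init_seq_commute U_colim source.init_seq_diagram)

lemma inj_commute:
  "X \<in> Obj A' \<Longrightarrow>
     Inj B (init_seq A B T (Fo V X)) i = Fa U (Inj B' (init_seq A' B' T' X) i)"
  by (simp add: init_seq_commute U_inj source.init_seq_diagram)

text \<open>Applying \<open>U\<close> to the equations that characterise the source arrow gives
  exactly those that characterise the target arrow, because legs and maps of sequences are carried
  to their counterparts.\<close>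

lemma dagger_arr_commute:
  assumes f: "f \<in> hom A' X Y"
  shows "dagger_arr A B T (Fa V f) = Fa U (dagger_arr A' B' T' f)"
proof (rule target.dagger_arr_eqI[OF functor_hom[OF V f]])
  have XY: "X \<in> Obj A'" "Y \<in> Obj A'"
    using f source.A.hom_obj by auto
  show "Fa U (dagger_arr A' B' T' f)
      \<in> hom B (dagger_obj A B T (Fo V X)) (dagger_obj A B T (Fo V Y))"
    using functor_hom[OF U source.dagger_arr_hom[OF f]] by (simp add: dagger_obj_commute XY)
  show "Fa U (dagger_arr A' B' T' f) \<cdot>\<^bsub>B\<^esub> Inj B (init_seq A B T (Fo V X)) i =
      Inj B (init_seq A B T (Fo V Y)) i \<cdot>\<^bsub>B\<^esub> init_map B T (Fa V f) i" for i
    using source.dagger_arr_inj[OF f, of i]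
      functor_cmp[OF U source.inj_hom[OF XY(1)] source.dagger_arr_hom[OF f], of i]
      functor_cmp[OF U source.init_map_hom[OF f] source.inj_hom[OF XY(2)], of i]
    by (simp add: inj_commute XY init_map_commute[OF f])
qed

lemma dagger_commute: "functor_eq A' B (dagger A B T \<circ>\<^sub>F V) (U \<circ>\<^sub>F dagger A' B' T')"
  unfolding functor_eq_def
  using fcomp_functor[OF V target.dagger_functor] fcomp_functor[OF source.dagger_functor U]
    dagger_arr_commute[OF Arr_hom]
  by (simp add: fcomp_def dagger_def dagger_obj_commute)

end

section \<open>Interpretations of types\<close>

text \<open>Distinctness makes the position of a variable unique, so the description in the variable
  clause of \<open>interp\<close> recovers the index from the derivation.\<close>

lemma the_nth_index:
  "distinct \<Theta> \<Longrightarrow> i < length \<Theta> \<Longrightarrow> (THE j. j < length \<Theta> \<and> \<Theta> ! j = \<Theta> ! i) = i"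
  by (rule the_equality) (auto simp: nth_eq_iff_index_eq)

text \<open>Collects what the standard and the affine interpretation have in common, so that
  functoriality is proved once for both.\<close>

locale interpretation_data = omega_category B for B :: "('o, 'm, 'z) omega_cat_scheme" +
  fixes \<A> :: "'a set" and u :: 'o and at :: "'a \<Rightarrow> 'o"
    and S P :: "('o \<times> 'o, 'm \<times> 'm, 'o, 'm) fctr"
  assumes u_obj: "u \<in> Obj B"
    and at_obj: "a \<in> \<A> \<Longrightarrow> at a \<in> Obj B"
    and S: "is_functor (prod_cat B B) B S"
    and P: "is_functor (prod_cat B B) B P"
begin

lemma parameterised_snoc:
  assumes "is_functor (power_cat B (Suc n)) B F"
  shows "parameterised (power_cat B n) B (F \<circ>\<^sub>F snoc)"
  using fcomp_functor[OF snoc_functor assms] power_category[OF category_axioms]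
  by (intro parameterised.intro parameterised_axioms.intro omega_category_axioms)

lemma interp_functor:
  "wf_ty \<A> \<Theta> A \<Longrightarrow> is_functor (power_cat B (length \<Theta>)) B (interp B u at S P A \<Theta>)"
proof (induction rule: wf_ty.induct)
  case (wf_TVar \<Theta> i)
  then show ?case
    by (simp add: the_nth_index fproj_functor)
next
  case (wf_TMu \<Theta> X A)
  \<comment> \<open>The premise lives in the context extended by \<open>X\<close>, so the induction
    hypothesis speaks of the power with exponent one larger, as \<open>parameterised_snoc\<close>
    requires.\<close>
  then show ?case
    using parameterised.dagger_functor[OF parameterised_snoc] by simp
qed (simp_all add: fconst_functor u_obj at_obj fcomp_functor[OF ftuple_functor] S P)

end

lemma functor_eqD_obj: "functor_eq C D F G \<Longrightarrow> A \<in> Obj C \<Longrightarrow> Fo F A = Fo G A"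
  and functor_eqD_arr: "functor_eq C D F G \<Longrightarrow> f \<in> Arr C \<Longrightarrow> Fa F f = Fa G f"
  by (simp_all add: functor_eq_def)

text \<open>Constants are compared on objects; on arrows a constant functor yields an identity,
  which the functor \<open>U\<close> preserves.\<close>

locale interpretation_morphism =
  source: interpretation_data B' \<A> u' at' S' P' + target: interpretation_data B \<A> u at S P
  for B' :: "('o, 'm, 'z) omega_cat_scheme" and \<A> :: "'a set" and u' at' S' P'
    and B :: "('o2, 'm2, 'z2) omega_cat_scheme" and u at S P +
  fixes U :: "('o, 'm, 'o2, 'm2) fctr"
  assumes U_strict: "strict_omega_functor B' B U"
    and U_u: "Fo U u' = u"
    and U_at: "a \<in> \<A> \<Longrightarrow> Fo U (at' a) = at a"
    and U_S_obj: "X \<in> Obj B' \<Longrightarrow> Y \<in> Obj B' \<Longrightarrow> Fo S (Fo U X, Fo U Y) = Fo U (Fo S' (X, Y))"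
    and U_S_arr: "f \<in> Arr B' \<Longrightarrow> g \<in> Arr B' \<Longrightarrow> Fa S (Fa U f, Fa U g) = Fa U (Fa S' (f, g))"
    and U_P_obj: "X \<in> Obj B' \<Longrightarrow> Y \<in> Obj B' \<Longrightarrow> Fo P (Fo U X, Fo U Y) = Fo U (Fo P' (X, Y))"
    and U_P_arr: "f \<in> Arr B' \<Longrightarrow> g \<in> Arr B' \<Longrightarrow> Fa P (Fa U f, Fa U g) = Fa U (Fa P' (f, g))"
begin

lemma U: "is_functor B' B U"
  using U_strict by (simp add: strict_omega_functor_def)

lemma interp_commute:
  "wf_ty \<A> \<Theta> A \<Longrightarrow>
     functor_eq (power_cat B' (length \<Theta>)) B
       (interp B u at S P A \<Theta> \<circ>\<^sub>F fpower U) (U \<circ>\<^sub>F interp B' u' at' S' P' A \<Theta>)"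
proof (induction rule: wf_ty.induct)
  case (wf_TMu \<Theta> X A)
  let ?n = "length \<Theta>"
  let ?F = "interp B u at S P A (\<Theta> @ [X])" and ?F' = "interp B' u' at' S' P' A (\<Theta> @ [X])"
  note eq = wf_TMu.IH
  have "is_functor (power_cat B (Suc ?n)) B ?F" "is_functor (power_cat B' (Suc ?n)) B' ?F'"
    using target.interp_functor[OF wf_TMu.hyps] source.interp_functor[OF wf_TMu.hyps] by simp_all
  then interpret m: parameterised_morphism "power_cat B' ?n" B' "?F' \<circ>\<^sub>F snoc"
      "power_cat B ?n" B "?F \<circ>\<^sub>F snoc" "fpower U" U
  proof (intro parameterised_morphism.intro parameterised_morphism_axioms.intro
      source.parameterised_snoc target.parameterised_snoc U_strict fpower_functor[OF U])
    \<comment> \<open>Evaluating the induction hypothesis at the list with \<open>Y\<close> appended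
      gives the square, since \<open>fpower U\<close> acts on the appended entry as \<open>U\<close>
      does.\<close>
    fix Xs Y assume "Xs \<in> Obj (power_cat B' ?n)" "Y \<in> Obj B'"
    then show "Fo (?F \<circ>\<^sub>F snoc) (Fo (fpower U) Xs, Fo U Y) = Fo U (Fo (?F' \<circ>\<^sub>F snoc) (Xs, Y))"
      using functor_eqD_obj[OF eq, of "Xs @ [Y]"]
      by (simp add: fcomp_def snoc_def fpower_def power_cat_simps)
  next
    fix fs g assume "fs \<in> Arr (power_cat B' ?n)" "g \<in> Arr B'"
    then show "Fa (?F \<circ>\<^sub>F snoc) (Fa (fpower U) fs, Fa U g) = Fa U (Fa (?F' \<circ>\<^sub>F snoc) (fs, g))"
      using functor_eqD_arr[OF eq, of "fs @ [g]"]
      by (simp add: fcomp_def snoc_def fpower_def power_cat_simps)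
  qed
  show ?case
    using m.dagger_commute by simp
next
  case (wf_TVar \<Theta> i)
  then show ?case
    using fcomp_functor[OF fpower_functor[OF U] fproj_functor] fcomp_functor[OF fproj_functor U]
    unfolding functor_eq_def
    by (auto simp: the_nth_index fcomp_def fproj_def fpower_def power_cat_simps)
next
  case (wf_TUnit \<Theta>)
  then show ?case
    using fcomp_functor[OF fpower_functor[OF U] target.fconst_functor[OF target.u_obj]]
      fcomp_functor[OF source.fconst_functor[OF source.u_obj] U] functor_idt[OF U source.u_obj]
    unfolding functor_eq_def by (auto simp: fcomp_def fconst_def U_u)
next
  case (wf_TAtom \<Theta> a)
  then show ?case
    using fcomp_functor[OF fpower_functor[OF U] target.fconst_functor[OF target.at_obj]]
      fcomp_functor[OF source.fconst_functor[OF source.at_obj] U] functor_idt[OF U source.at_obj]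
    unfolding functor_eq_def by (auto simp: fcomp_def fconst_def U_at)
next
  case (wf_TSum \<Theta> A A')
  note functors = target.interp_functor[OF wf_ty.wf_TSum[OF wf_TSum.hyps]]
    source.interp_functor[OF wf_ty.wf_TSum[OF wf_TSum.hyps]]
  \<comment> \<open>The strictness equations for \<open>S\<close> are available on objects and
    arrows of \<open>B'\<close>, so the values of the source interpretations must be known to lie
    there.\<close>
  note functors' = source.interp_functor[OF wf_TSum.hyps(1)] source.interp_functor[OF wf_TSum.hyps(2)]
  show ?case
    unfolding functor_eq_def
    using fcomp_functor[OF fpower_functor[OF U] functors(1)] fcomp_functor[OF functors(2) U]
      wf_TSum.IH[THEN functor_eqD_obj] wf_TSum.IH[THEN functor_eqD_arr]
      functors'[THEN functor_obj] functors'[THEN functor_arr]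
    by (auto simp: fcomp_def ftuple_def U_S_obj U_S_arr)
next
  case (wf_TTensor \<Theta> A A')
  note functors = target.interp_functor[OF wf_ty.wf_TTensor[OF wf_TTensor.hyps]]
    source.interp_functor[OF wf_ty.wf_TTensor[OF wf_TTensor.hyps]]
  note functors' = source.interp_functor[OF wf_TTensor.hyps(1)]
    source.interp_functor[OF wf_TTensor.hyps(2)]
  show ?case
    unfolding functor_eq_def
    using fcomp_functor[OF fpower_functor[OF U] functors(1)] fcomp_functor[OF functors(2) U]
      wf_TTensor.IH[THEN functor_eqD_obj] wf_TTensor.IH[THEN functor_eqD_arr]
      functors'[THEN functor_obj] functors'[THEN functor_arr]
    by (auto simp: fcomp_def ftuple_def U_P_obj U_P_arr)
qed

end

section \<open>The slice category over the tensor unit\<close>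

lemma obj_slice_cat:
  "X \<in> Obj (slice_cat C) \<longleftrightarrow> fst X \<in> Obj C \<and> snd X \<in> hom C (fst X) (TensorUnit C)"
  by (cases X) (simp add: slice_cat_def)

lemma hom_slice_cat:
  "(X', f, Y') \<in> hom (slice_cat C) X Y \<longleftrightarrow> X' = X \<and> Y' = Y \<and>
     X \<in> Obj (slice_cat C) \<and> Y \<in> Obj (slice_cat C) \<and>
     f \<in> hom C (fst X) (fst Y) \<and> snd Y \<cdot>\<^bsub>C\<^esub> f = snd X"
  by (cases X; cases Y) (auto simp: hom_def slice_cat_def)

text \<open>Between fixed endpoints a slice arrow is determined by its middle component, so
  equations between parallel slice arrows reduce to equations in the base category.\<close>

lemma hom_slice_catE:
  assumes "F \<in> hom (slice_cat C) X Y"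
  obtains f where "F = (X, f, Y)" "X \<in> Obj (slice_cat C)" "Y \<in> Obj (slice_cat C)"
    "f \<in> hom C (fst X) (fst Y)" "snd Y \<cdot>\<^bsub>C\<^esub> f = snd X"
  using assms by (cases F) (auto simp: hom_slice_cat)

lemma arr_slice_cat: "(X, f, Y) \<in> Arr (slice_cat C) \<longleftrightarrow> (X, f, Y) \<in> hom (slice_cat C) X Y"
  by (auto simp: hom_def slice_cat_def)

lemma idt_slice_cat: "Idt (slice_cat C) X = (X, Idt C (fst X), X)"
  and cmp_slice_cat: "(Y', g, Z) \<cdot>\<^bsub>slice_cat C\<^esub> (X, f, Y) = (X, g \<cdot>\<^bsub>C\<^esub> f, Z)"
  and zero_slice_cat: "Zero (slice_cat C) = (Zero C, zero_arr C (TensorUnit C))"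
  and colim_slice_cat: "Colim (slice_cat C) = slice_colim C"
  and inj_slice_cat: "Inj (slice_cat C) D i = (fst D i, Inj C (map_seq forget D) i, slice_colim C D)"
  by (simp_all add: slice_cat_def)

lemmas slice_cat_simps = hom_slice_cat idt_slice_cat cmp_slice_cat

lemma fst_slice_colim: "fst (slice_colim C D) = Colim C (map_seq forget D)"
  by (simp add: slice_colim_def Let_def)

lemma forget_obj: "Fo forget X = fst X"
  and forget_arr: "Fa forget F = fst (snd F)"
  by (simp_all add: forget_def split_def)

lemma forget_functor: "is_functor (slice_cat C) C forget"
  by (rule is_functorI)
     (auto simp: forget_obj forget_arr obj_slice_cat slice_cat_simps elim!: hom_slice_catE)

section \<open>The slice as a category, and the tensor product on it\<close>

context symmetric_monoidal
begin

lemma tensor_obj: "X \<in> Obj C \<Longrightarrow> Y \<in> Obj C \<Longrightarrow> X \<otimes> Y \<in> Obj C"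
  using functor_obj[OF tensor_functor, of "(X, Y)"] by (simp add: prod_cat_simps)

lemma tensor_idt: "X \<in> Obj C \<Longrightarrow> Y \<in> Obj C \<Longrightarrow> Idt C X \<odot> Idt C Y = Idt C (X \<otimes> Y)"
  using functor_idt[OF tensor_functor, of "(X, Y)"] by (simp add: prod_cat_simps)

lemma tensor_hom:
  "f \<in> hom C X X' \<Longrightarrow> g \<in> hom C Y Y' \<Longrightarrow> f \<odot> g \<in> hom C (X \<otimes> Y) (X' \<otimes> Y')"
  using functor_hom[OF tensor_functor, of "(f, g)" "(X, Y)" "(X', Y')"]
  by (simp add: prod_cat_simps)

lemma tensor_cmp:
  assumes "f \<in> hom C X X'" "f' \<in> hom C X' X''" "g \<in> hom C Y Y'" "g' \<in> hom C Y' Y''"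
  shows "(f' \<odot> g') \<cdot> (f \<odot> g) = (f' \<cdot> f) \<odot> (g' \<cdot> g)"
  using functor_cmp[OF tensor_functor, of "(f, g)" "(X, Y)" "(X', Y')" "(f', g')" "(X'', Y'')"]
    assms by (simp add: prod_cat_simps)

lemma lunit_hom: "X \<in> Obj C \<Longrightarrow> LUnit C X \<in> hom C (TensorUnit C \<otimes> X) X"
  using lunit_iso by (simp add: iso_arr_def)

lemma slice_category: "category (slice_cat C)"
proof
  fix F assume F: "F \<in> Arr (slice_cat C)"
  obtain X f Y where eq: "F = (X, f, Y)"
    by (cases F)
  show "Dom (slice_cat C) F \<in> Obj (slice_cat C)" "Cod (slice_cat C) F \<in> Obj (slice_cat C)"
    using F unfolding eq by (auto simp: arr_slice_cat hom_slice_cat) (auto simp: slice_cat_def)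
next
  fix X assume "X \<in> Obj (slice_cat C)"
  then show "Idt (slice_cat C) X \<in> hom (slice_cat C) X X"
    by (auto simp: slice_cat_simps obj_slice_cat idt_hom intro: idt_right)
next
  fix F G X Y Z assume "F \<in> hom (slice_cat C) X Y" "G \<in> hom (slice_cat C) Y Z"
  then obtain f g where F: "F = (X, f, Y)" "f \<in> hom C (fst X) (fst Y)" "snd Y \<cdot> f = snd X"
    and G: "G = (Y, g, Z)" "g \<in> hom C (fst Y) (fst Z)" "snd Z \<cdot> g = snd Y"
    and obj: "X \<in> Obj (slice_cat C)" "Z \<in> Obj (slice_cat C)"
    by (auto elim!: hom_slice_catE)
  \<comment> \<open>Pasting the two triangles over the unit.\<close>
  have "snd Z \<cdot> (g \<cdot> f) = (snd Z \<cdot> g) \<cdot> f"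
    using obj(2) cmp_assoc[OF F(2) G(2), of "snd Z" "TensorUnit C"] by (simp add: obj_slice_cat)
  then show "G \<cdot>\<^bsub>slice_cat C\<^esub> F \<in> hom (slice_cat C) X Z"
    using F G obj cmp_hom[OF F(2) G(2)] by (simp add: slice_cat_simps)
next
  fix F X Y assume "F \<in> hom (slice_cat C) X Y"
  then show "Idt (slice_cat C) Y \<cdot>\<^bsub>slice_cat C\<^esub> F = F"
    and "F \<cdot>\<^bsub>slice_cat C\<^esub> Idt (slice_cat C) X = F"
    by (auto elim!: hom_slice_catE simp: slice_cat_simps intro: idt_left idt_right)
next
  fix F G H W X Y Z
  assume "F \<in> hom (slice_cat C) W X" "G \<in> hom (slice_cat C) X Y" "H \<in> hom (slice_cat C) Y Z"
  then show "(H \<cdot>\<^bsub>slice_cat C\<^esub> G) \<cdot>\<^bsub>slice_cat C\<^esub> F =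
             H \<cdot>\<^bsub>slice_cat C\<^esub> (G \<cdot>\<^bsub>slice_cat C\<^esub> F)"
    by (auto elim!: hom_slice_catE simp: slice_cat_simps intro: cmp_assoc)
qed

lemma unit_slice_obj: "(TensorUnit C, Idt C (TensorUnit C)) \<in> Obj (slice_cat C)"
  by (simp add: obj_slice_cat unit_obj idt_hom)

lemma slice_tensor_obj:
  assumes "X \<in> Obj (slice_cat C)" "Y \<in> Obj (slice_cat C)"
  shows "slice_tensor_obj C X Y \<in> Obj (slice_cat C)"
  using assms
  by (auto simp: obj_slice_cat slice_tensor_obj_def tensor_obj
        intro: cmp_hom tensor_hom lunit_hom unit_obj)

text \<open>Bifunctoriality merges the two triangles into one over the tensor square of the unit;
  composing with the left unitor leaves the equation intact.\<close>

lemma slice_tensor_hom: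
  assumes "(X, f, X') \<in> hom (slice_cat C) X X'" "(Y, g, Y') \<in> hom (slice_cat C) Y Y'"
  shows "(slice_tensor_obj C X Y, f \<odot> g, slice_tensor_obj C X' Y')
    \<in> hom (slice_cat C) (slice_tensor_obj C X Y) (slice_tensor_obj C X' Y')"
proof -
  let ?I = "TensorUnit C"
  have f: "f \<in> hom C (fst X) (fst X')" "snd X' \<in> hom C (fst X') ?I" "snd X' \<cdot> f = snd X"
    and g: "g \<in> hom C (fst Y) (fst Y')" "snd Y' \<in> hom C (fst Y') ?I" "snd Y' \<cdot> g = snd Y"
    using assms by (auto simp: hom_slice_cat obj_slice_cat)
  have "(LUnit C ?I \<cdot> (snd X' \<odot> snd Y')) \<cdot> (f \<odot> g) = LUnit C ?I \<cdot> ((snd X' \<odot> snd Y') \<cdot> (f \<odot> g))"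
    by (rule cmp_assoc[OF tensor_hom[OF f(1) g(1)] tensor_hom[OF f(2) g(2)]
          lunit_hom[OF unit_obj]])
  also have "(snd X' \<odot> snd Y') \<cdot> (f \<odot> g) = snd X \<odot> snd Y"
    using f g by (simp add: tensor_cmp)
  finally show ?thesis
    using assms slice_tensor_obj f g
    by (auto simp: hom_slice_cat) (auto simp: slice_tensor_obj_def intro: tensor_hom)
qed

lemma slice_tensor_functor:
  "is_functor (prod_cat (slice_cat C) (slice_cat C)) (slice_cat C) (slice_tensor C)"
proof (rule is_functorI)
  fix Z assume Z: "Z \<in> Obj (prod_cat (slice_cat C) (slice_cat C))"
  then show "Fo (slice_tensor C) Z \<in> Obj (slice_cat C)"
    by (auto simp: slice_tensor_def prod_cat_simps slice_tensor_obj)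
  show "Fa (slice_tensor C) (Idt (prod_cat (slice_cat C) (slice_cat C)) Z) =
      Idt (slice_cat C) (Fo (slice_tensor C) Z)"
    using Z by (auto simp: slice_tensor_def prod_cat_simps idt_slice_cat slice_tensor_obj_def
        obj_slice_cat tensor_idt)
next
  fix Z Z' F assume "F \<in> hom (prod_cat (slice_cat C) (slice_cat C)) Z Z'"
  then show "Fa (slice_tensor C) F
      \<in> hom (slice_cat C) (Fo (slice_tensor C) Z) (Fo (slice_tensor C) Z')"
    by (cases Z; cases Z'; cases F)
       (auto simp: slice_tensor_def prod_cat_simps elim!: hom_slice_catE
         intro!: slice_tensor_hom, auto simp: hom_slice_cat)
next
  fix Z Z' Z'' F G
  assume "F \<in> hom (prod_cat (slice_cat C) (slice_cat C)) Z Z'"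
    "G \<in> hom (prod_cat (slice_cat C) (slice_cat C)) Z' Z''"
  then show "Fa (slice_tensor C) (G \<cdot>\<^bsub>prod_cat (slice_cat C) (slice_cat C)\<^esub> F) =
      Fa (slice_tensor C) G \<cdot>\<^bsub>slice_cat C\<^esub> Fa (slice_tensor C) F"
    by (cases Z; cases Z'; cases Z''; cases F; cases G)
       (auto simp: slice_tensor_def prod_cat_simps cmp_slice_cat tensor_cmp elim!: hom_slice_catE)
qed

end

context aff_model
begin

section \<open>Chosen colimits and the initial object of the slice\<close>

lemma forget_diagram:
  assumes "omega_diagram (slice_cat C) D"
  shows "omega_diagram C (map_seq forget D)"
  using assms functor_obj[OF forget_functor, of _ C] functor_hom[OF forget_functor, of _ C]
  by (simp add: omega_diagram_def map_seq_def)

text \<open>Splits a slice cocone into a cocone in the base and a triangle over the unit for each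
  leg. The second fact rebuilds a leg from its underlying arrow, so that equations can be lifted
  back to the slice.\<close>

lemma forget_cocone:
  assumes "is_cocone (slice_cat C) D N \<nu>" "omega_diagram (slice_cat C) D"
  shows "is_cocone C (map_seq forget D) (fst N) (\<lambda>i. fst (snd (\<nu> i)))"
    and "\<nu> i = (fst D i, fst (snd (\<nu> i)), N)"
    and "snd N \<cdot> fst (snd (\<nu> i)) = snd (fst D i)"
proof -
  have N: "N \<in> Obj (slice_cat C)" and \<nu>: "\<nu> i \<in> hom (slice_cat C) (fst D i) N"
    and nat: "\<nu> (Suc i) \<cdot>\<^bsub>slice_cat C\<^esub> snd D i = \<nu> i" for i
    using assms(1) by (auto simp: is_cocone_def)
  have D: "snd D i \<in> hom (slice_cat C) (fst D i) (fst D (Suc i))" for i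
    using assms(2) by (simp add: omega_diagram_def)
  show "\<nu> i = (fst D i, fst (snd (\<nu> i)), N)" "snd N \<cdot> fst (snd (\<nu> i)) = snd (fst D i)"
    using \<nu>[of i] by (auto elim!: hom_slice_catE)
  show "is_cocone C (map_seq forget D) (fst N) (\<lambda>i. fst (snd (\<nu> i)))"
    using functor_obj[OF forget_functor N] functor_hom[OF forget_functor \<nu>]
      functor_cmp[OF forget_functor D \<nu>, symmetric]
    by (simp add: is_cocone_def map_seq_def nat forget_obj forget_arr)
qed

text \<open>The arrows of a slice diagram lie over the unit, hence the structure arrows of its
  objects form a cocone with the unit as vertex. The description in \<open>slice_colim\<close> is
  its mediating arrow; the last fact turns uniqueness into a criterion.\<close>

lemma slice_colim_props:
  assumes D: "omega_diagram (slice_cat C) D"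
  shows "slice_colim C D \<in> Obj (slice_cat C)"
    and "snd (slice_colim C D) \<cdot> Inj C (map_seq forget D) i = snd (fst D i)"
    and "\<lbrakk>d \<in> hom C (Colim C (map_seq forget D)) (TensorUnit C);
          \<And>i. d \<cdot> Inj C (map_seq forget D) i = snd (fst D i)\<rbrakk> \<Longrightarrow> d = snd (slice_colim C D)"
proof -
  let ?M = "Colim C (map_seq forget D)" and ?\<mu> = "Inj C (map_seq forget D)"
  let ?P = "\<lambda>d. d \<in> hom C ?M (TensorUnit C) \<and> (\<forall>i. d \<cdot> ?\<mu> i = snd (fst D i))"
  have col: "is_colimit C (map_seq forget D) ?M ?\<mu>"
    by (rule colim[OF forget_diagram[OF D]])
  have "is_cocone C (map_seq forget D) (TensorUnit C) (\<lambda>i. snd (fst D i))"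
    unfolding is_cocone_def
  proof (intro conjI allI)
    fix i
    have "fst D i \<in> Obj (slice_cat C)" "snd D i \<in> hom (slice_cat C) (fst D i) (fst D (Suc i))"
      using D by (auto simp: omega_diagram_def)
    then show "snd (fst D i) \<in> hom C (fst (map_seq forget D) i) (TensorUnit C)"
      and "snd (fst D (Suc i)) \<cdot> snd (map_seq forget D) i = snd (fst D i)"
      by (auto simp: map_seq_def forget_obj forget_arr obj_slice_cat elim!: hom_slice_catE)
  qed (rule unit_obj)
  then have ex1: "\<exists>!d. ?P d"
    using col unfolding is_colimit_def by blast
  have snd: "snd (slice_colim C D) = (THE d. ?P d)"
    by (simp add: slice_colim_def Let_def)
  have P: "?P (snd (slice_colim C D))"
    unfolding snd by (rule theI'[OF ex1])
  then show "slice_colim C D \<in> Obj (slice_cat C)"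
    using col by (simp add: obj_slice_cat fst_slice_colim is_colimit_def is_cocone_def)
  show "snd (slice_colim C D) \<cdot> ?\<mu> i = snd (fst D i)"
    using P by blast
  show "\<lbrakk>d \<in> hom C ?M (TensorUnit C); \<And>i. d \<cdot> ?\<mu> i = snd (fst D i)\<rbrakk> \<Longrightarrow>
      d = snd (slice_colim C D)"
    using P ex1 by blast
qed

lemma slice_colimit:
  assumes D: "omega_diagram (slice_cat C) D"
  shows "is_colimit (slice_cat C) D (Colim (slice_cat C) D) (Inj (slice_cat C) D)"
proof -
  let ?M = "Colim C (map_seq forget D)" and ?\<mu> = "Inj C (map_seq forget D)"
  let ?L = "slice_colim C D"
  have col: "is_colimit C (map_seq forget D) ?M ?\<mu>"
    by (rule colim[OF forget_diagram[OF D]])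
  have \<mu>: "?\<mu> i \<in> hom C (fst (fst D i)) ?M" "?\<mu> (Suc i) \<cdot> snd (map_seq forget D) i = ?\<mu> i" for i
    using col by (simp_all add: is_colimit_def is_cocone_def map_seq_def forget_obj)
  have Dobj: "fst D i \<in> Obj (slice_cat C)"
    and Darr: "snd D i \<in> hom (slice_cat C) (fst D i) (fst D (Suc i))" for i
    using D by (auto simp: omega_diagram_def)
  have "is_cocone (slice_cat C) D ?L (Inj (slice_cat C) D)"
    unfolding is_cocone_def
  proof (intro conjI allI)
    show "?L \<in> Obj (slice_cat C)"
      by (rule slice_colim_props(1)[OF D])
    fix i
    show "Inj (slice_cat C) D i \<in> hom (slice_cat C) (fst D i) ?L"
      using slice_colim_props(1,2)[OF D] Dobj \<mu>(1)
      by (simp add: inj_slice_cat hom_slice_cat fst_slice_colim)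
    show "Inj (slice_cat C) D (Suc i) \<cdot>\<^bsub>slice_cat C\<^esub> snd D i = Inj (slice_cat C) D i"
      using Darr[of i] \<mu>(2)[of i]
      by (auto simp: inj_slice_cat cmp_slice_cat map_seq_def forget_arr elim!: hom_slice_catE)
  qed
  moreover have "\<exists>!H. H \<in> hom (slice_cat C) ?L N \<and>
      (\<forall>i. H \<cdot>\<^bsub>slice_cat C\<^esub> Inj (slice_cat C) D i = \<nu> i)"
    if cocone: "is_cocone (slice_cat C) D N \<nu>" for N \<nu>
  proof -
    let ?\<nu> = "\<lambda>i. fst (snd (\<nu> i))"
    note N = forget_cocone[OF cocone D]
    have Nobj: "N \<in> Obj (slice_cat C)"
      using cocone by (simp add: is_cocone_def)
    obtain h where h: "h \<in> hom C ?M (fst N)" "\<And>i. h \<cdot> ?\<mu> i = ?\<nu> i"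
      and uniq: "\<And>h'. h' \<in> hom C ?M (fst N) \<Longrightarrow> (\<And>i. h' \<cdot> ?\<mu> i = ?\<nu> i) \<Longrightarrow> h' = h"
      using col N(1) unfolding is_colimit_def by metis
    have dN: "snd N \<in> hom C (fst N) (TensorUnit C)"
      using Nobj by (simp add: obj_slice_cat)
    \<comment> \<open>The mediating arrow of the base lies over the unit automatically: on each leg,
      \<open>snd N \<cdot> h\<close> restricts to the structure arrow of \<open>fst D i\<close>, and
      this characterises \<open>snd ?L\<close>.\<close>
    have "snd N \<cdot> h = snd ?L"
    proof (rule slice_colim_props(3)[OF D])
      show "snd N \<cdot> h \<in> hom C ?M (TensorUnit C)"
        by (rule cmp_hom[OF h(1) dN])
      show "(snd N \<cdot> h) \<cdot> ?\<mu> i = snd (fst D i)" for i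
        using cmp_assoc[OF \<mu>(1) h(1) dN, of i] h(2) N(3) by simp
    qed
    then have H: "(?L, h, N) \<in> hom (slice_cat C) ?L N"
      using h(1) Nobj slice_colim_props(1)[OF D] by (simp add: hom_slice_cat fst_slice_colim)
    show ?thesis
    proof (rule ex1I[of _ "(?L, h, N)"], intro conjI allI)
      show "(?L, h, N) \<cdot>\<^bsub>slice_cat C\<^esub> Inj (slice_cat C) D i = \<nu> i" for i
        using N(2)[of i] by (simp add: inj_slice_cat cmp_slice_cat h(2))
    next
      fix H' assume H': "H' \<in> hom (slice_cat C) ?L N \<and>
        (\<forall>i. H' \<cdot>\<^bsub>slice_cat C\<^esub> Inj (slice_cat C) D i = \<nu> i)"
      \<comment> \<open>The endpoints being fixed, uniqueness in the slice reduces to uniqueness of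
        the underlying arrow.\<close>
      then obtain h' where eq: "H' = (?L, h', N)" and h': "h' \<in> hom C ?M (fst N)"
        by (auto elim!: hom_slice_catE simp: fst_slice_colim)
      have "h' \<cdot> ?\<mu> i = ?\<nu> i" for i
        using conjunct2[OF H', THEN spec, of i, symmetric]
        by (simp add: eq inj_slice_cat cmp_slice_cat)
      then show "H' = (?L, h, N)"
        using uniq[OF h'] by (simp add: eq)
    qed (rule H)
  qed
  ultimately show ?thesis
    by (simp add: is_colimit_def colim_slice_cat)
qed

lemma slice_omega_category: "omega_category (slice_cat C)"
proof (intro omega_category.intro slice_category omega_category_axioms.intro slice_colimit)
  have dI: "zero_arr C (TensorUnit C) \<in> hom C (Zero C) (TensorUnit C)"
    by (rule zero_arr_hom[OF unit_obj])
  then show zero: "Zero (slice_cat C) \<in> Obj (slice_cat C)"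
    by (simp add: zero_slice_cat obj_slice_cat zero_obj)
  fix X assume X: "X \<in> Obj (slice_cat C)"
  then have X': "fst X \<in> Obj C" "snd X \<in> hom C (fst X) (TensorUnit C)"
    by (auto simp: obj_slice_cat)
  \<comment> \<open>The triangle over the unit commutes because both of its sides start at the
    initial object.\<close>
  have "snd X \<cdot> zero_arr C (fst X) = zero_arr C (TensorUnit C)"
    using zero_arr_unique[OF unit_obj cmp_hom[OF zero_arr_hom X'(2)] dI] X' by blast
  then have "(Zero (slice_cat C), zero_arr C (fst X), X) \<in> hom (slice_cat C) (Zero (slice_cat C)) X"
    using X zero zero_arr_hom[OF X'(1)] by (simp add: hom_slice_cat) (simp add: zero_slice_cat)
  then show "\<exists>!F. F \<in> hom (slice_cat C) (Zero (slice_cat C)) X"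
  proof (rule ex1I)
    fix F assume "F \<in> hom (slice_cat C) (Zero (slice_cat C)) X"
    then obtain f where "F = (Zero (slice_cat C), f, X)" "f \<in> hom C (Zero C) (fst X)"
      by (auto elim!: hom_slice_catE simp: zero_slice_cat)
    then show "F = (Zero (slice_cat C), zero_arr C (fst X), X)"
      using zero_arr_unique[OF X'(1) _ zero_arr_hom[OF X'(1)]] by simp
  qed
qed

text \<open>True by construction: the chosen data of the slice have the chosen data of the base as
  their underlying objects and arrows.\<close>

lemma forget_strict: "strict_omega_functor (slice_cat C) C forget"
  unfolding strict_omega_functor_def
  by (simp add: forget_functor forget_obj forget_arr zero_slice_cat colim_slice_cat
      inj_slice_cat fst_slice_colim)

section \<open>Copairing and functoriality of the coproduct\<close>

lemma copair_hom:
  "f \<in> hom C X Z \<Longrightarrow> g \<in> hom C Y Z \<Longrightarrow> copair C f g \<in> hom C (Sum C X Y) Z"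
  and copair_inl: "f \<in> hom C X Z \<Longrightarrow> g \<in> hom C Y Z \<Longrightarrow> copair C f g \<cdot> InL C X Y = f"
  and copair_inr: "f \<in> hom C X Z \<Longrightarrow> g \<in> hom C Y Z \<Longrightarrow> copair C f g \<cdot> InR C X Y = g"
  using theI'[OF sum_universal, of f X Z g Y] homD[of f C X Z] homD[of g C Y Z]
  by (simp_all add: copair_def Let_def)

text \<open>The types of \<open>f\<close> and \<open>g\<close> are read off from the composites of
  \<open>h\<close> with the injections, so a caller types only \<open>h\<close> and the
  summands.\<close>

lemma copair_eqI:
  assumes "h \<in> hom C (Sum C X Y) Z" "X \<in> Obj C" "Y \<in> Obj C"
    and "h \<cdot> InL C X Y = f" "h \<cdot> InR C X Y = g"
  shows "copair C f g = h"
proof -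
  have f: "f \<in> hom C X Z" and g: "g \<in> hom C Y Z"
    using assms(4,5) cmp_hom[OF inl_hom[OF assms(2,3)] assms(1)]
      cmp_hom[OF inr_hom[OF assms(2,3)] assms(1)] by simp_all
  from sum_universal[OF f g] show ?thesis
    by (rule ex1E) (metis copair_hom[OF f g] copair_inl[OF f g] copair_inr[OF f g] assms(1,4,5))
qed

lemma sum_arr_eq_copair:
  assumes "f \<in> hom C X X'" "g \<in> hom C Y Y'"
  shows "sum_arr C f g = copair C (InL C X' Y' \<cdot> f) (InR C X' Y' \<cdot> g)"
  using assms by (simp add: sum_arr_def homD)

lemma sum_legs_hom:
  assumes "f \<in> hom C X X'" "g \<in> hom C Y Y'"
  shows "InL C X' Y' \<cdot> f \<in> hom C X (Sum C X' Y')" "InR C X' Y' \<cdot> g \<in> hom C Y (Sum C X' Y')"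
  using hom_obj[OF assms(1)] hom_obj[OF assms(2)]
  by (auto intro: cmp_hom[OF assms(1) inl_hom] cmp_hom[OF assms(2) inr_hom])

lemma sum_arr_hom:
  "f \<in> hom C X X' \<Longrightarrow> g \<in> hom C Y Y' \<Longrightarrow> sum_arr C f g \<in> hom C (Sum C X Y) (Sum C X' Y')"
  by (simp add: sum_arr_eq_copair copair_hom sum_legs_hom)

text \<open>The fusion law, checked on both injections. It yields the composition law of the sum as
  well as the triangle over the unit for sums of slice arrows.\<close>

lemma copair_sum_arr:
  assumes f: "f \<in> hom C X X'" and g: "g \<in> hom C Y Y'"
    and a: "a \<in> hom C X' Z" and b: "b \<in> hom C Y' Z"
  shows "copair C a b \<cdot> sum_arr C f g = copair C (a \<cdot> f) (b \<cdot> g)"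
proof (rule copair_eqI[symmetric])
  have obj: "X \<in> Obj C" "Y \<in> Obj C" "X' \<in> Obj C" "Y' \<in> Obj C"
    using f g hom_obj by auto
  then show "X \<in> Obj C" "Y \<in> Obj C"
    by simp_all
  note ab = copair_hom[OF a b] and fg = sum_arr_hom[OF f g]
  show "copair C a b \<cdot> sum_arr C f g \<in> hom C (Sum C X Y) Z"
    by (rule cmp_hom[OF fg ab])
  show "(copair C a b \<cdot> sum_arr C f g) \<cdot> InL C X Y = a \<cdot> f"
    using cmp_assoc[OF inl_hom[OF obj(1,2)] fg ab] cmp_assoc[OF f inl_hom[OF obj(3,4)] ab]
    by (simp add: sum_arr_eq_copair[OF f g] copair_inl[OF sum_legs_hom[OF f g]] copair_inl[OF a b])
  show "(copair C a b \<cdot> sum_arr C f g) \<cdot> InR C X Y = b \<cdot> g"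
    using cmp_assoc[OF inr_hom[OF obj(1,2)] fg ab] cmp_assoc[OF g inr_hom[OF obj(3,4)] ab]
    by (simp add: sum_arr_eq_copair[OF f g] copair_inr[OF sum_legs_hom[OF f g]] copair_inr[OF a b])
qed

lemma sum_arr_idt:
  assumes "X \<in> Obj C" "Y \<in> Obj C"
  shows "sum_arr C (Idt C X) (Idt C Y) = Idt C (Sum C X Y)"
proof -
  have "copair C (InL C X Y \<cdot> Idt C X) (InR C X Y \<cdot> Idt C Y) = Idt C (Sum C X Y)"
    using inl_hom[OF assms] inr_hom[OF assms]
    by (intro copair_eqI[OF idt_hom[OF sum_obj[OF assms]] assms]) (simp_all add: idt_left idt_right)
  then show ?thesis
    using assms by (simp add: sum_arr_eq_copair[OF idt_hom idt_hom])
qed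

lemma sum_arr_cmp:
  assumes f: "f \<in> hom C X X'" and f': "f' \<in> hom C X' X''"
    and g: "g \<in> hom C Y Y'" and g': "g' \<in> hom C Y' Y''"
  shows "sum_arr C f' g' \<cdot> sum_arr C f g = sum_arr C (f' \<cdot> f) (g' \<cdot> g)"
proof -
  have obj: "X'' \<in> Obj C" "Y'' \<in> Obj C"
    using f' g' hom_obj by auto
  show ?thesis
    \<comment> \<open>Written as a copairing of injections after \<open>f'\<close> and
      \<open>g'\<close>, the second sum falls under the fusion law; associativity regroups the
      legs.\<close>
    by (simp add: sum_arr_eq_copair[OF f' g'] copair_sum_arr[OF f g sum_legs_hom[OF f' g']]
        sum_arr_eq_copair[OF cmp_hom[OF f f'] cmp_hom[OF g g']]
        cmp_assoc[OF f f' inl_hom[OF obj]] cmp_assoc[OF g g' inr_hom[OF obj]])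
qed

lemma sum_functor: "is_functor (prod_cat C C) C (sum_functor C)"
  by (rule is_functorI)
     (auto simp: sum_functor_def prod_cat_simps sum_obj sum_arr_idt sum_arr_hom sum_arr_cmp)

section \<open>The coproduct functor on the slice\<close>

lemma slice_sum_obj:
  assumes "X \<in> Obj (slice_cat C)" "Y \<in> Obj (slice_cat C)"
  shows "slice_sum_obj C X Y \<in> Obj (slice_cat C)"
  using assms by (auto simp: obj_slice_cat slice_sum_obj_def sum_obj copair_hom)

lemma slice_sum_hom:
  assumes "(X, f, X') \<in> hom (slice_cat C) X X'" "(Y, g, Y') \<in> hom (slice_cat C) Y Y'"
  shows "(slice_sum_obj C X Y, sum_arr C f g, slice_sum_obj C X' Y')
    \<in> hom (slice_cat C) (slice_sum_obj C X Y) (slice_sum_obj C X' Y')"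
proof -
  have f: "f \<in> hom C (fst X) (fst X')" "snd X' \<in> hom C (fst X') (TensorUnit C)"
      "snd X' \<cdot> f = snd X"
    and g: "g \<in> hom C (fst Y) (fst Y')" "snd Y' \<in> hom C (fst Y') (TensorUnit C)"
      "snd Y' \<cdot> g = snd Y"
    using assms by (auto simp: hom_slice_cat obj_slice_cat)
  \<comment> \<open>The structure arrow of a slice sum is a copairing, so the fusion law reduces its
    triangle to those of \<open>f\<close> and \<open>g\<close>.\<close>
  have "copair C (snd X') (snd Y') \<cdot> sum_arr C f g = copair C (snd X) (snd Y)"
    using copair_sum_arr[OF f(1) g(1) f(2) g(2)] f(3) g(3) by simp
  then show ?thesis
    using assms slice_sum_obj f g
    by (auto simp: hom_slice_cat) (auto simp: slice_sum_obj_def intro: sum_arr_hom)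
qed

lemma slice_sum_functor:
  "is_functor (prod_cat (slice_cat C) (slice_cat C)) (slice_cat C) (slice_sum C)"
proof (rule is_functorI)
  fix Z assume Z: "Z \<in> Obj (prod_cat (slice_cat C) (slice_cat C))"
  then show "Fo (slice_sum C) Z \<in> Obj (slice_cat C)"
    by (auto simp: slice_sum_def prod_cat_simps slice_sum_obj)
  show "Fa (slice_sum C) (Idt (prod_cat (slice_cat C) (slice_cat C)) Z) =
      Idt (slice_cat C) (Fo (slice_sum C) Z)"
    using Z by (auto simp: slice_sum_def prod_cat_simps idt_slice_cat slice_sum_obj_def
        obj_slice_cat sum_arr_idt)
next
  fix Z Z' F assume "F \<in> hom (prod_cat (slice_cat C) (slice_cat C)) Z Z'"
  then show "Fa (slice_sum C) F
      \<in> hom (slice_cat C) (Fo (slice_sum C) Z) (Fo (slice_sum C) Z')"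
    by (cases Z; cases Z'; cases F)
       (auto simp: slice_sum_def prod_cat_simps elim!: hom_slice_catE
         intro!: slice_sum_hom, auto simp: hom_slice_cat)
next
  fix Z Z' Z'' F G
  assume "F \<in> hom (prod_cat (slice_cat C) (slice_cat C)) Z Z'"
    "G \<in> hom (prod_cat (slice_cat C) (slice_cat C)) Z' Z''"
  then show "Fa (slice_sum C) (G \<cdot>\<^bsub>prod_cat (slice_cat C) (slice_cat C)\<^esub> F) =
      Fa (slice_sum C) G \<cdot>\<^bsub>slice_cat C\<^esub> Fa (slice_sum C) F"
    by (cases Z; cases Z'; cases Z''; cases F; cases G)
       (auto simp: slice_sum_def prod_cat_simps cmp_slice_cat sum_arr_cmp elim!: hom_slice_catE)
qed

text \<open>The slice operations act on underlying objects and arrows as the operations of the base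
  do, so the strictness equations for sum and tensor unfold to identities; the substance is in
  functoriality and \<open>forget_strict\<close>.\<close>

lemma interpretation_forget:
  "interpretation_morphism (slice_cat C) \<A> (TensorUnit C, Idt C (TensorUnit C))
     (\<lambda>a. (Atom C a, Discard C a)) (slice_sum C) (slice_tensor C)
     C (TensorUnit C) (Atom C) (sum_functor C) (Tensor C) forget"
proof (intro interpretation_morphism.intro interpretation_data.intro
    interpretation_data_axioms.intro interpretation_morphism_axioms.intro)
  show "(Atom C a, Discard C a) \<in> Obj (slice_cat C)" if "a \<in> \<A>" for a
    using that by (simp add: obj_slice_cat atom_obj discard_hom)
qed (simp_all add: slice_omega_category omega_category_axioms unit_slice_obj unit_obj atom_obj
    slice_sum_functor sum_functor slice_tensor_functor tensor_functor forget_strict,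
    simp_all add: forget_obj forget_arr sum_functor_def slice_sum_def slice_tensor_def
    slice_sum_obj_def slice_tensor_obj_def split_def)

end

theorem theorem35:
  fixes \<A> :: "'a set" and C :: "('o, 'm, 'a) aff_data"
  assumes "aff_model \<A> C"
  shows "(\<forall>(\<Theta> :: 'v list) A. wf_ty \<A> \<Theta> A \<longrightarrow>
            functor_eq (power_cat (slice_cat C) (length \<Theta>)) C
              (std_interp C \<Theta> A \<circ>\<^sub>F fpower forget) (forget \<circ>\<^sub>F aff_interp C \<Theta> A)) \<and>
         (\<forall>A :: ('a, 'v) ty. closed_ty \<A> A \<longrightarrow>
            std_interp_closed C A = Fo forget (aff_interp_closed C A))"
proof -
  interpret aff_model \<A> C by fact
  have eq: "functor_eq (power_cat (slice_cat C) (length \<Theta>)) C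
      (std_interp C \<Theta> A \<circ>\<^sub>F fpower forget) (forget \<circ>\<^sub>F aff_interp C \<Theta> A)"
    if "wf_ty \<A> \<Theta> A" for \<Theta> :: "'v list" and A
    using interpretation_morphism.interp_commute[OF interpretation_forget that]
    by (simp add: std_interp_def aff_interp_def)
  have "std_interp_closed C A = Fo forget (aff_interp_closed C A)"
    if "closed_ty \<A> A" for A :: "('a, 'v) ty"
    \<comment> \<open>The zeroth power has the single object \<open>[]\<close>, which
      \<open>fpower forget\<close> sends to \<open>[]\<close>.\<close>
    using functor_eqD_obj[OF eq[OF that], of "[]"]
    by (simp add: std_interp_closed_def aff_interp_closed_def fcomp_def fpower_def power_cat_simps)
  with eq show ?thesis
    by blast
qed

end
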